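(* Let $n\ge3$, $p>1$ and $F(u)=|u|^p$. Assume $f\equiv0$ and $g(x)=g(|x|)$ with $g\in C_0^2([0,\infty))$ such that (i) $\operatorname{supp} g\subset\{x\in\mathbb{R}^n:|x|\le k\}$ for some $k>0$, and (ii) there exists $k_0$ with $0<k_0<k$ such that $g(|x|)>0$ for $k_0<|x|<k$. Then there exist $\varepsilon_0=\varepsilon_0(g,n,p,k)>0$ and a constant $C>0$ independent of $\varepsilon$ such that for all $0<\varepsilon\le\varepsilon_0$, \[ \widehat{T}(\varepsilon)\le C\varepsilon^{-2p(p-1)/\zeta(p,n)}\quad\text{if }1<p<p_1(n),\qquad \widehat{T}(\varepsilon)\le \exp\left(C\varepsilon^{-p(p-1)}\right)\quad\text{if }p=p_1(n). \]
   Context: $\omega_n=2\pi^{n/2}/\Gamma(n/2)$. For $(x,t)\in\mathbb{R}^n\times[0,\infty)$ define $V(x,t)=\frac{1}{\omega_n}\int_{|\omega|=1}\left(\frac{t\,\omega\cdot\nabla f}{n-2}+f+tg\right)(x+t\omega)\,dS_\omega$ and $N(G)(x,t)=\frac{1}{(n-2)\omega_n}\int_0^t(t-\tau)\,d\tau\int_{|\omega|=1}G(x+(t-\tau)\omega,\tau)\,dS_\omega$. The lifespan $\widehat{T}(\varepsilon)$ is the supremum of $t>0$ such that there exists a solution $u$ on $\mathbb{R}^n\times[0,t]$ of the integral equation $u=\varepsilon V+N(F(u))$ (a $C^2$ solution when $p\ge2$, a $C^1$ solution when $1<p<2$). Set $\zeta(p,n)=2\left(1+(n-1)p-(n-2)p^2\right)$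 and $p_1(n)=\frac{n-1+\sqrt{n^2+2n-7}}{2(n-2)}$, the positive root of $\zeta(p,n)=0$. *)

theory Defs
  imports "HOL-Analysis.Analysis"
begin

text \<open>omega_n = 2 pi^(n/2) / Gamma(n/2), the area of the unit sphere in R^n.\<close>
definition omega_n :: "nat \<Rightarrow> real" where
  "omega_n n = 2 * pi powr (real n / 2) / Gamma (real n / 2)"

text \<open>Integral over the unit sphere with respect to surface measure dS, expressed through
  the cone-measure identity: the integral of h over the unit sphere equals
  n times the Lebesgue integral over the closed unit ball of h(y/|y|).\<close>
definition sphere_int :: "('a::euclidean_space \<Rightarrow> real) \<Rightarrow> real" where
  "sphere_int h = real DIM('a) * (LINT y : cball 0 1 | lborel. h (y /\<^sub>R norm y))"

definition zeta :: "real \<Rightarrow> real \<Rightarrow> real" where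
  "zeta p n = 2 * (1 + (n - 1) * p - (n - 2) * p\<^sup>2)"

definition p1 :: "real \<Rightarrow> real" where
  "p1 n = (n - 1 + sqrt (n\<^sup>2 + 2 * n - 7)) / (2 * (n - 2))"

definition Vfree :: "('a::euclidean_space \<Rightarrow> real) \<Rightarrow> ('a \<Rightarrow> real) \<Rightarrow> 'a \<times> real \<Rightarrow> real" where
  "Vfree f g = (\<lambda>(x, t). (1 / omega_n DIM('a)) *
     sphere_int (\<lambda>\<omega>. t * frechet_derivative f (at (x + t *\<^sub>R \<omega>)) \<omega> / (real DIM('a) - 2)
                      + f (x + t *\<^sub>R \<omega>) + t * g (x + t *\<^sub>R \<omega>)))"

definition Nop :: "('a::euclidean_space \<times> real \<Rightarrow> real) \<Rightarrow> 'a \<times> real \<Rightarrow> real" where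
  "Nop G = (\<lambda>(x, t). (1 / ((real DIM('a) - 2) * omega_n DIM('a))) *
     (LINT \<tau> : {0..t} | lborel. (t - \<tau>) * sphere_int (\<lambda>\<omega>. G (x + (t - \<tau>) *\<^sub>R \<omega>, \<tau>))))"

definition C1_on :: "'a::real_normed_vector set \<Rightarrow> ('a \<Rightarrow> real) \<Rightarrow> bool" where
  "C1_on S u \<longleftrightarrow> (\<exists>u'. (\<forall>z\<in>S. (u has_derivative u' z) (at z within S)) \<and>
                        (\<forall>v. continuous_on S (\<lambda>z. u' z v)))"

definition C2_on :: "'a::real_normed_vector set \<Rightarrow> ('a \<Rightarrow> real) \<Rightarrow> bool" where
  "C2_on S u \<longleftrightarrow> (\<exists>u'. (\<forall>z\<in>S. (u has_derivative u' z) (at z within S)) \<and>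
                        (\<forall>v. C1_on S (\<lambda>z. u' z v)))"

definition is_solution :: "real \<Rightarrow> real \<Rightarrow> ('a::euclidean_space \<Rightarrow> real) \<Rightarrow> ('a \<times> real \<Rightarrow> real) \<Rightarrow> real \<Rightarrow> bool" where
  "is_solution p eps g u T \<longleftrightarrow>
     (if p \<ge> 2 then C2_on (UNIV \<times> {0..T}) u else C1_on (UNIV \<times> {0..T}) u) \<and>
     (\<forall>x. \<forall>t\<in>{0..T}. u (x, t) = eps * Vfree (\<lambda>_. 0) g (x, t) + Nop (\<lambda>z. \<bar>u z\<bar> powr p) (x, t))"

definition lifespan :: "real \<Rightarrow> real \<Rightarrow> ('a::euclidean_space \<Rightarrow> real) \<Rightarrow> ereal" where
  "lifespan p eps g = Sup (ereal ` {T. T > 0 \<and> (\<exists>u. is_solution p eps g u T)})"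

end

(*
  The iteration only uses pointwise lower bounds that depend on |x| and t, so no averaging of a
  possibly nonradial u is needed. Write n for the dimension and beta = t - |x|. After exchanging the tau- and the
  omega-integrals in N, the strip a <= beta <= b is crossed by each backward ray from (x,t) in time
  at least (b - a)/2, because tau - |x + (t - tau) omega| is monotone and 2-Lipschitz in tau.
  Rays with |omega + x/|x|| <= beta/(4t) enter the strip at tau <= beta, and they form a cap of
  area ~ (beta/t)^(n-1); this replaces the explicit kernel of spherical means.

  Applied to u >= eps v t^(2-n) on a strip where g > 0, this gives
    u >= l t^(2-n) beta^(n-1-(n-2)p)   with l = A eps^p
  for beta >= 2k, a bound homogeneous in (x,t). If zeta(p,n) = 0, the strips beta ~ B 4^j contribute
  equally, so l grows by c l^p whenever beta is multiplied by 4 and exceeds any constant after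
  O(eps^(-p(p-1))) such steps. On the backward cone with vertex (0,T) and height T/3 a
  homogeneous bound with l^(p-1) T^(zeta/2) large is improved without end by iteration, which
  contradicts the continuity of u at the vertex.
*)
theory Submission
  imports Defs
begin

section \<open>Measure of the cone over a spherical cap\<close>

text \<open>Because \<open>sphere_int\<close> is an integral over the solid ball, a cap is measured
  through the cone over it. Along its axis, between radii 1/2 and 1, this cone contains of the order
  of 1 / \<rho> disjoint balls with radius proportional to \<rho>, each of volume of order \<rho> ^
  n; together they give \<rho> ^ (n - 1) without polar coordinates.\<close>

lemma measure_cap_ge:
  "\<exists>c>0. \<forall>(e::'a::euclidean_space) \<rho>. norm e = 1 \<longrightarrow> 0 < \<rho> \<longrightarrow> \<rho> \<le> 1 \<longrightarrow>
     c * \<rho> ^ (DIM('a) - 1) \<le> measure lborel {y \<in> cball 0 1. norm (y /\<^sub>R norm y - e) \<le> \<rho>}"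
proof (intro exI conjI allI impI)
  let ?v = "unit_ball_vol (real DIM('a))"
  show "0 < ?v / 8 ^ DIM('a)"
    by simp
  fix e :: 'a and \<rho> :: real
  assume e: "norm e = 1" and \<rho>: "0 < \<rho>" "\<rho> \<le> 1"
  \<comment> \<open>A point within \<sigma> of an axis point of norm s \<ge> 1/2 has norm above 3/8,
    so its direction deviates from e by at most 2 \<sigma> / (3/8) = 2 \<rho> / 3.\<close>
  define \<sigma> where "\<sigma> = \<rho> / 8"
  define N where "N = nat \<lfloor>1 / (4 * \<sigma>)\<rfloor>"
  define z where "z j = (1 / 2 + 2 * real j * \<sigma>) *\<^sub>R e" for j
  let ?cap = "{y \<in> cball 0 1. norm (y /\<^sub>R norm y - e) \<le> \<rho>}"
  have \<sigma>: "0 < \<sigma>" "\<sigma> \<le> 1 / 8"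
    using \<rho> by (auto simp: \<sigma>_def)
  \<comment> \<open>Rounding down a number that is at least 2 loses at most half of it, so
    \<open>N\<close> stays comparable to 1 / \<sigma>.\<close>
  have "2 \<le> 1 / (4 * \<sigma>)"
    using \<sigma> by (simp add: field_simps)
  then have N1: "real N \<le> 1 / (4 * \<sigma>)" and N2: "1 / (4 * \<sigma>) \<le> 2 * real N"
    unfolding N_def by linarith+
  have sub: "ball (z j) \<sigma> \<subseteq> ?cap" if "j < N" for j
  proof
    fix y assume y: "y \<in> ball (z j) \<sigma>"
    define s where "s = 1 / 2 + 2 * real j * \<sigma>"
    have zs: "z j = s *\<^sub>R e"
      by (simp add: z_def s_def)
    have "real j + 1 \<le> real N"
      using that by linarith
    then have "2 * real j * \<sigma> + 2 * \<sigma> \<le> 2 * \<sigma> * (1 / (4 * \<sigma>))"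
      using N1 \<sigma> mult_left_mono[of "real j + 1" "1 / (4 * \<sigma>)" "2 * \<sigma>"] by (simp add: algebra_simps)
    then have s: "1 / 2 \<le> s" "s \<le> 1 - 2 * \<sigma>"
      using \<sigma> by (auto simp: s_def)
    have d: "norm (y - s *\<^sub>R e) < \<sigma>"
      using y by (simp add: zs dist_norm norm_minus_commute)
    have "\<bar>norm y - norm (s *\<^sub>R e)\<bar> < \<sigma>"
      using d norm_triangle_ineq3[of y "s *\<^sub>R e"] by linarith
    then have ny: "\<bar>norm y - s\<bar> < \<sigma>"
      using s e by simp
    then have y0: "norm y > 3 / 8"
      using s \<sigma> by linarith
    have "norm (y /\<^sub>R norm y - e) = norm ((y - s *\<^sub>R e) + (s - norm y) *\<^sub>R e) / norm y"
    proof -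
      have "y /\<^sub>R norm y - e = ((y - s *\<^sub>R e) + (s - norm y) *\<^sub>R e) /\<^sub>R norm y"
      proof -
        have "norm y * inverse (norm y) = 1"
          using y0 by (intro right_inverse) auto
        then show ?thesis
          by (simp add: algebra_simps)
      qed
      then show ?thesis
        by (metis abs_norm_cancel divide_inverse_commute norm_inverse norm_scaleR real_norm_def)
    qed
    also have "\<dots> \<le> (norm (y - s *\<^sub>R e) + \<bar>s - norm y\<bar>) / norm y"
      using e norm_triangle_ineq[of "y - s *\<^sub>R e" "(s - norm y) *\<^sub>R e"]
      by (intro divide_right_mono) auto
    also have "\<dots> \<le> 2 * \<sigma> / (3 / 8)"
      using d ny y0 \<sigma> by (intro frac_le) auto
    also have "\<dots> \<le> \<rho>"
      using \<rho> by (simp add: \<sigma>_def)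
    finally show "y \<in> ?cap"
      using ny s \<sigma> by simp
  qed
  have "disjoint_family_on (\<lambda>j. ball (z j) \<sigma>) {..<N}"
    unfolding disjoint_family_on_def
  proof (intro ballI impI)
    fix i j :: nat assume "i \<noteq> j"
    then have "1 \<le> \<bar>real i - real j\<bar>"
      by linarith
    then have "2 * \<sigma> \<le> 2 * \<sigma> * \<bar>real i - real j\<bar>"
      using \<sigma> by simp
    moreover have "dist (z i) (z j) = 2 * \<sigma> * \<bar>real i - real j\<bar>"
    proof -
      have "z i - z j = (2 * \<sigma> * (real i - real j)) *\<^sub>R e"
        by (simp add: z_def algebra_simps)
      then show ?thesis
        using e \<sigma> by (simp add: dist_norm abs_mult)
    qed
    ultimately show "ball (z i) \<sigma> \<inter> ball (z j) \<sigma> = {}"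
      by (intro disjoint_ballI) simp
  qed
  then have "measure lborel (\<Union>j<N. ball (z j) \<sigma>) = (\<Sum>j<N. measure lborel (ball (z j) \<sigma>))"
    by (intro measure_finite_Union) (use emeasure_lborel_ball_finite in \<open>auto simp: less_top\<close>)
  also have "\<dots> = real N * (?v * \<sigma> ^ DIM('a))"
    using \<sigma> by (simp add: content_ball)
  finally have m: "measure lborel (\<Union>j<N. ball (z j) \<sigma>) = real N * (?v * \<sigma> ^ DIM('a))" .
  have DIM: "\<sigma> ^ DIM('a) = \<sigma> * \<sigma> ^ (DIM('a) - 1)" "8 ^ DIM('a) = (8::real) * 8 ^ (DIM('a) - 1)"
    by (metis DIM_positive power_eq_if not_gr_zero)+
  have "1 \<le> real N * \<sigma> * 8"
    using N2 \<sigma> by (simp add: field_simps)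
  then have "?v * \<sigma> ^ (DIM('a) - 1) / 8 * 1 \<le> ?v * \<sigma> ^ (DIM('a) - 1) / 8 * (real N * \<sigma> * 8)"
    using \<sigma> by (intro mult_left_mono) auto
  then have "?v / 8 ^ DIM('a) * \<rho> ^ (DIM('a) - 1) \<le> real N * (?v * \<sigma> ^ DIM('a))"
    unfolding DIM by (simp add: \<sigma>_def power_divide field_simps)
  also have "\<dots> = measure lborel (\<Union>j<N. ball (z j) \<sigma>)"
    by (simp add: m)
  also have "\<dots> \<le> measure lborel ?cap"
  proof (rule measure_mono_fmeasurable)
    have "?cap \<in> sets lborel"
      by measurable
    moreover have "emeasure lborel ?cap < \<infinity>"
      by (intro emeasure_bounded_finite bounded_subset[OF bounded_cball[of 0 1]]) auto
    ultimately show "?cap \<in> fmeasurable lborel"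
      by (simp add: fmeasurable_def)
  qed (use sub in auto)
  finally show "?v / 8 ^ DIM('a) * \<rho> ^ (DIM('a) - 1) \<le> measure lborel ?cap" .
qed

section \<open>Lower bounds for the operator \<open>Nop\<close>\<close>

lemma omega_n_pos: "n \<ge> 1 \<Longrightarrow> omega_n n > 0"
  unfolding omega_n_def by (intro divide_pos_pos mult_pos_pos Gamma_real_pos) auto

lemma Nop_ge:
  fixes G :: "'a::euclidean_space \<times> real \<Rightarrow> real" and x :: 'a
  assumes dim: "DIM('a) \<ge> 3" and t: "0 \<le> t"
    and cont: "continuous_on (UNIV \<times> {0..t}) G" and nonneg: "\<And>z. 0 \<le> G z"
    and D: "D \<in> sets borel" "D \<subseteq> cball 0 1"
    and m: "\<And>y. y \<in> D \<Longrightarrow> m \<le> (LINT \<tau>:{0..t}|lborel. (t - \<tau>) * G (x + (t - \<tau>) *\<^sub>R (y /\<^sub>R norm y), \<tau>))"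
  shows "real DIM('a) / ((real DIM('a) - 2) * omega_n DIM('a)) * measure lborel D * m \<le> Nop G (x, t)"
proof -
  \<comment> \<open>Clamping the time to [0, t] gives a function that is continuous, hence
    measurable, on the whole space, although \<open>G\<close> is controlled only on the
    slab.\<close>
  define G' where "G' z = G (fst z, max 0 (min t (snd z)))" for z
  have contG': "continuous_on UNIV G'"
    unfolding G'_def using t
    by (intro continuous_on_compose2[OF cont] continuous_intros) auto
  then have [measurable]: "G' \<in> borel_measurable (borel \<Otimes>\<^sub>M borel)"
    unfolding borel_prod by (rule borel_measurable_continuous_onI)
  have [measurable]: "cball (0::'a) 1 \<in> sets borel"
    by simp
  have G': "G' (y, \<tau>) = G (y, \<tau>)" if "\<tau> \<in> {0..t}" for y \<tau>
    using that by (simp add: G'_def)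
  define H where "H \<tau> y = (t - \<tau>) * G' (x + (t - \<tau>) *\<^sub>R (y /\<^sub>R norm y), \<tau>)" for \<tau> and y :: 'a
  define F where "F \<tau> y = indicator {0..t} \<tau> * (indicator (cball 0 1) y * H \<tau> y)" for \<tau> y
  have H_nonneg: "0 \<le> H \<tau> y" if "\<tau> \<in> {0..t}" for \<tau> y
    using that nonneg by (simp add: H_def G'_def)
  \<comment> \<open>All rays stay in this compact set; the resulting bound \<open>K\<close> gives
    the integrability that Fubini requires.\<close>
  have "compact (G' ` (cball x t \<times> {0..t}))"
    by (intro compact_continuous_image continuous_on_subset[OF contG'] compact_Times) auto
  then have "bounded (G' ` (cball x t \<times> {0..t}))"
    by (rule compact_imp_bounded)
  then obtain K where K: "\<And>z. z \<in> cball x t \<times> {0..t} \<Longrightarrow> \<bar>G' z\<bar> \<le> K"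
    unfolding bounded_iff by auto
  have F_int: "integrable (lborel \<Otimes>\<^sub>M lborel) (\<lambda>(\<tau>, y). F \<tau> y)"
  proof (rule integrableI_bounded_set)
    show "{0..t} \<times> cball 0 1 \<in> sets (lborel \<Otimes>\<^sub>M (lborel :: 'a measure))"
      by measurable
    show "(\<lambda>(\<tau>, y). F \<tau> y) \<in> borel_measurable (lborel \<Otimes>\<^sub>M lborel)"
      unfolding F_def H_def by measurable
    show "emeasure (lborel \<Otimes>\<^sub>M (lborel :: 'a measure)) ({0..t} \<times> cball 0 1) < \<infinity>"
      unfolding lborel_prod by (intro emeasure_bounded_finite bounded_Times) auto
    show "AE z\<in>{0..t} \<times> cball 0 1 in lborel \<Otimes>\<^sub>M (lborel :: 'a measure).
        norm (case z of (\<tau>, y) \<Rightarrow> F \<tau> y) \<le> t * K"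
    proof (intro AE_I2 impI)
      fix z :: "real \<times> 'a" assume z: "z \<in> {0..t} \<times> cball 0 1"
      obtain \<tau> y where [simp]: "z = (\<tau>, y)" by force
      have \<tau>: "0 \<le> \<tau>" "\<tau> \<le> t" using z by auto
      have "norm ((t - \<tau>) *\<^sub>R (y /\<^sub>R norm y)) \<le> (t - \<tau>) * 1"
        unfolding norm_scaleR[of "t - \<tau>"] using \<tau>
        by (intro mult_mono) (auto simp: field_simps)
      then have "\<bar>G' (x + (t - \<tau>) *\<^sub>R (y /\<^sub>R norm y), \<tau>)\<bar> \<le> K"
        using \<tau> by (intro K) (auto simp: dist_norm)
      then have "\<bar>H \<tau> y\<bar> \<le> t * K"
        unfolding H_def abs_mult using \<tau> by (intro mult_mono) auto
      then show "norm (case z of (\<tau>, y) \<Rightarrow> F \<tau> y) \<le> t * K"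
        using z by (simp add: F_def)
    qed
    show "AE z in lborel \<Otimes>\<^sub>M (lborel :: 'a measure). z \<notin> {0..t} \<times> cball 0 1 \<longrightarrow> (case z of (\<tau>, y) \<Rightarrow> F \<tau> y) = 0"
      by (auto simp: F_def indicator_def)
  qed
  let ?c = "1 / ((real DIM('a) - 2) * omega_n DIM('a))"
  have c: "0 \<le> ?c"
    using dim omega_n_pos[of "DIM('a)"] by simp
  have sph: "indicator {0..t} \<tau> *\<^sub>R ((t - \<tau>) * sphere_int (\<lambda>\<omega>. G (x + (t - \<tau>) *\<^sub>R \<omega>, \<tau>)))
      = real DIM('a) * (LINT y|lborel. F \<tau> y)" for \<tau>
  proof (cases "\<tau> \<in> {0..t}")
    case True
    then have "F \<tau> y = (t - \<tau>) * (indicator (cball 0 1) y *\<^sub>R G (x + (t - \<tau>) *\<^sub>R (y /\<^sub>R norm y), \<tau>))" for y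
      by (simp add: F_def H_def G')
    then show ?thesis
      using True by (simp add: sphere_int_def set_lebesgue_integral_def)
  qed (simp add: F_def)
  have "Nop G (x, t) = ?c * (LINT \<tau>|lborel. real DIM('a) * (LINT y|lborel. F \<tau> y))"
    unfolding Nop_def prod.case set_lebesgue_integral_def sph ..
  also have "(LINT \<tau>|lborel. real DIM('a) * (LINT y|lborel. F \<tau> y)) = real DIM('a) * (LINT y|lborel. (LINT \<tau>|lborel. F \<tau> y))"
    using lborel_pair.Fubini_integral[OF F_int] by simp
  finally have N: "Nop G (x, t) = ?c * (real DIM('a) * (LINT y|lborel. (LINT \<tau>|lborel. F \<tau> y)))" .
  have "emeasure lborel D < \<infinity>"
    using D by (intro emeasure_bounded_finite bounded_subset[OF bounded_cball]) auto
  have "measure lborel D * m = (LINT y|lborel. indicator D y * m)"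
    using D by simp
  also have "\<dots> \<le> (LINT y|lborel. (LINT \<tau>|lborel. F \<tau> y))"
  proof (rule integral_mono)
    show "integrable lborel (\<lambda>y. indicator D y * m)"
      using D \<open>emeasure lborel D < \<infinity>\<close> by (intro integrable_mult_left integrable_real_indicator) auto
    show "integrable lborel (\<lambda>y. LINT \<tau>|lborel. F \<tau> y)"
      by (rule lborel_pair.integrable_snd[OF F_int])
    show "indicator D y * m \<le> (LINT \<tau>|lborel. F \<tau> y)" for y
    proof (cases "y \<in> D")
      case True
      have "m \<le> (LINT \<tau>:{0..t}|lborel. (t - \<tau>) * G (x + (t - \<tau>) *\<^sub>R (y /\<^sub>R norm y), \<tau>))"
        by (rule m[OF True])
      also have "\<dots> = (LINT \<tau>|lborel. F \<tau> y)"
        unfolding set_lebesgue_integral_def using True D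
        by (intro Bochner_Integration.integral_cong refl) (auto simp: F_def H_def G' indicator_def)
      finally show ?thesis
        using True by simp
    next
      case False
      then show ?thesis
        using H_nonneg by (simp add: F_def indicator_def)
    qed
  qed
  finally have "?c * (real DIM('a) * (measure lborel D * m)) \<le> Nop G (x, t)"
    unfolding N using c by (intro mult_left_mono) auto
  then show ?thesis
    by (simp add: mult_ac)
qed

text \<open>Along the ray, \<phi> (time minus norm of the position) is nondecreasing and 2-Lipschitz
  and rises from at most 0 to \<beta>. It therefore stays in [a j, b j] for a time of at least (b j
  - a j) / 2. The weight t - \<tau> is at least t / 8 there because the ray is nearly antiradial,
  whence the factor t / 16.\<close>

lemma cone_line_integral_ge:
  fixes G :: "'a::euclidean_space \<times> real \<Rightarrow> real" and x \<omega> e :: 'a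
  assumes cont: "continuous_on (UNIV \<times> {0..t}) G" and nonneg: "\<And>z. 0 \<le> G z"
    and \<omega>: "norm \<omega> = 1" and e: "norm e = 1" "x = norm x *\<^sub>R e"
    and \<beta>: "\<beta> = t - norm x" "0 < \<beta>" and cap: "t * norm (\<omega> + e) \<le> \<beta> / 4"
    and J: "finite J" "\<And>j. j \<in> J \<Longrightarrow> 0 \<le> a j \<and> a j \<le> b j \<and> b j \<le> \<beta> / 2 \<and> 0 \<le> g j"
    and lower: "\<And>y \<tau>. 0 \<le> \<tau> \<Longrightarrow> \<tau> \<le> \<beta> \<Longrightarrow>
      (\<Sum>j\<in>J. g j * indicator {a j..b j} (\<tau> - norm y)) \<le> G (y, \<tau>)"
  shows "t / 16 * (\<Sum>j\<in>J. g j * (b j - a j))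
    \<le> (LINT \<tau>:{0..t}|lborel. (t - \<tau>) * G (x + (t - \<tau>) *\<^sub>R \<omega>, \<tau>))"
proof -
  define \<phi> where "\<phi> \<tau> = \<tau> - norm (x + (t - \<tau>) *\<^sub>R \<omega>)" for \<tau>
  have t: "0 < t"
    using \<beta> by (smt (verit) norm_ge_zero)
  have diff: "\<bar>norm (x + (t - \<sigma>) *\<^sub>R \<omega>) - norm (x + (t - \<tau>) *\<^sub>R \<omega>)\<bar> \<le> \<bar>\<sigma> - \<tau>\<bar>" for \<sigma> \<tau>
  proof -
    have "norm ((x + (t - \<sigma>) *\<^sub>R \<omega>) - (x + (t - \<tau>) *\<^sub>R \<omega>)) = norm ((\<tau> - \<sigma>) *\<^sub>R \<omega>)"
      by (simp add: algebra_simps)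
    also have "\<dots> = \<bar>\<sigma> - \<tau>\<bar>"
      using \<omega> by simp
    finally show ?thesis
      using norm_triangle_ineq3 by metis
  qed
  have mono: "\<phi> \<sigma> \<le> \<phi> \<tau>" and lip: "\<phi> \<tau> - \<phi> \<sigma> \<le> 2 * (\<tau> - \<sigma>)" if "\<sigma> \<le> \<tau>" for \<sigma> \<tau>
    using diff[of \<sigma> \<tau>] that by (auto simp: \<phi>_def)
  have \<phi>cont: "continuous_on {0..t} \<phi>"
    unfolding \<phi>_def by (intro continuous_intros)
  have ends: "\<phi> 0 \<le> 0" "\<phi> t = \<beta>"
    using \<beta> by (auto simp: \<phi>_def)
  \<comment> \<open>The cap condition keeps the ray within \<beta> / 4 of the straight ray from x in
    direction -e. For \<tau> \<ge> \<beta> this would give \<phi> \<tau> \<ge> 3 \<beta> / 4, so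
    \<phi> \<tau> \<le> \<beta> / 2 forces \<tau> \<le> 7 \<beta> / 8 \<le> 7 t / 8.\<close>
  have near: "\<tau> \<le> \<beta> \<and> t / 8 \<le> t - \<tau>" if "0 \<le> \<tau>" "\<tau> \<le> t" "\<phi> \<tau> \<le> \<beta> / 2" for \<tau>
  proof -
    have "x + (t - \<tau>) *\<^sub>R \<omega> = (norm x - (t - \<tau>)) *\<^sub>R e + (t - \<tau>) *\<^sub>R (\<omega> + e)"
      using e by (simp add: algebra_simps)
    then have "norm (x + (t - \<tau>) *\<^sub>R \<omega>) \<le> norm ((norm x - (t - \<tau>)) *\<^sub>R e) + norm ((t - \<tau>) *\<^sub>R (\<omega> + e))"
      by (metis norm_triangle_ineq)
    also have "\<dots> = \<bar>norm x - (t - \<tau>)\<bar> + (t - \<tau>) * norm (\<omega> + e)"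
      using e that by simp
    also have "(t - \<tau>) * norm (\<omega> + e) \<le> t * norm (\<omega> + e)"
      using that by (intro mult_right_mono) auto
    finally have "norm (x + (t - \<tau>) *\<^sub>R \<omega>) \<le> \<bar>norm x - (t - \<tau>)\<bar> + \<beta> / 4"
      using cap by simp
    moreover have "t - (t - \<tau>) - norm (x + (t - \<tau>) *\<^sub>R \<omega>) \<le> \<beta> / 2"
      using that(3) by (simp add: \<phi>_def)
    ultimately show ?thesis
      using \<beta> norm_ge_zero[of x] by linarith
  qed
  \<comment> \<open>Entry and exit times come from the intermediate value theorem; monotonicity
    keeps \<phi> in the strip between them and the Lipschitz bound separates them.\<close>
  have "\<exists>l r. 0 \<le> l \<and> l \<le> r \<and> r \<le> t \<and> b j - a j \<le> 2 * (r - l) \<and> (\<forall>\<tau>\<in>{l..r}. \<phi> \<tau> \<in> {a j..b j})"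
    if "j \<in> J" for j
  proof -
    have ab: "0 \<le> a j" "a j \<le> b j" "b j \<le> \<beta>"
      using J(2)[OF that] \<beta> by auto
    obtain r where r: "0 \<le> r" "r \<le> t" "\<phi> r = b j"
      using IVT'[of \<phi> 0 "b j" t] ends ab t \<phi>cont by auto
    obtain l where l: "0 \<le> l" "l \<le> r" "\<phi> l = a j"
      using IVT'[of \<phi> 0 "a j" r] ends ab r continuous_on_subset[OF \<phi>cont, of "{0..r}"] by auto
    show ?thesis
      using l r lip[OF l(2)] mono by (intro exI[of _ l] exI[of _ r]) (auto, metis, metis)
  qed
  then obtain l r where lr: "\<And>j. j \<in> J \<Longrightarrow> 0 \<le> l j \<and> l j \<le> r j \<and> r j \<le> t \<and>
      b j - a j \<le> 2 * (r j - l j) \<and> (\<forall>\<tau>\<in>{l j..r j}. \<phi> \<tau> \<in> {a j..b j})"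
    by metis
  have restrict: "indicator {0..t} \<tau> *\<^sub>R (\<Sum>j\<in>J. t / 8 * g j * indicator {l j..r j} \<tau>)
      = (\<Sum>j\<in>J. t / 8 * g j * indicator {l j..r j} \<tau>)" for \<tau>
    unfolding scaleR_sum_right
    by (intro sum.cong refl) (use lr in \<open>force simp: indicator_def\<close>)
  have "t / 16 * (\<Sum>j\<in>J. g j * (b j - a j)) \<le> t / 16 * (\<Sum>j\<in>J. g j * (2 * (r j - l j)))"
    using t lr J by (intro mult_left_mono sum_mono) auto
  also have "\<dots> = (\<Sum>j\<in>J. t / 8 * g j * (r j - l j))"
    unfolding sum_distrib_left by (intro sum.cong refl) (simp add: field_simps)
  also have "\<dots> = (LINT \<tau>|lborel. (\<Sum>j\<in>J. t / 8 * g j * indicator {l j..r j} \<tau>))"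
    using lr by (subst Bochner_Integration.integral_sum) auto
  also have "\<dots> = (LINT \<tau>:{0..t}|lborel. (\<Sum>j\<in>J. t / 8 * g j * indicator {l j..r j} \<tau>))"
    by (simp only: set_lebesgue_integral_def restrict)
  also have "\<dots> \<le> (LINT \<tau>:{0..t}|lborel. (t - \<tau>) * G (x + (t - \<tau>) *\<^sub>R \<omega>, \<tau>))"
  proof (rule set_integral_mono)
    show "set_integrable lborel {0..t} (\<lambda>\<tau>. \<Sum>j\<in>J. t / 8 * g j * indicator {l j..r j} \<tau>)"
      unfolding set_integrable_def restrict
      by (intro Bochner_Integration.integrable_sum integrable_mult_right integrable_real_indicator)
        (auto simp: emeasure_lborel_Icc_eq)
    show "set_integrable lborel {0..t} (\<lambda>\<tau>. (t - \<tau>) * G (x + (t - \<tau>) *\<^sub>R \<omega>, \<tau>))"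
      by (intro borel_integrable_atLeastAtMost' continuous_intros continuous_on_compose2[OF cont]) auto
    fix \<tau> assume \<tau>: "\<tau> \<in> {0..t}"
    show "(\<Sum>j\<in>J. t / 8 * g j * indicator {l j..r j} \<tau>) \<le> (t - \<tau>) * G (x + (t - \<tau>) *\<^sub>R \<omega>, \<tau>)"
    proof (cases "\<exists>j\<in>J. \<tau> \<in> {l j..r j}")
      case True
      then obtain j where "j \<in> J" "\<phi> \<tau> \<in> {a j..b j}"
        using lr by blast
      then have \<tau>': "\<tau> \<le> \<beta>" "t / 8 \<le> t - \<tau>"
        using near[of \<tau>] \<tau> J(2)[of j] by auto
      have "(\<Sum>j\<in>J. t / 8 * g j * indicator {l j..r j} \<tau>) \<le> t / 8 * (\<Sum>j\<in>J. g j * indicator {a j..b j} (\<phi> \<tau>))"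
        unfolding sum_distrib_left mult.assoc using t J lr
        by (intro sum_mono mult_left_mono) (auto simp: indicator_def)
      also have "\<dots> \<le> t / 8 * G (x + (t - \<tau>) *\<^sub>R \<omega>, \<tau>)"
        using lower[of \<tau> "x + (t - \<tau>) *\<^sub>R \<omega>"] \<tau> \<tau>' t by (intro mult_left_mono) (auto simp: \<phi>_def)
      also have "\<dots> \<le> (t - \<tau>) * G (x + (t - \<tau>) *\<^sub>R \<omega>, \<tau>)"
        using \<tau>' nonneg by (intro mult_right_mono)
      finally show ?thesis .
    next
      case False
      then have "(\<Sum>j\<in>J. t / 8 * g j * indicator {l j..r j} \<tau>) = 0"
        by (intro sum.neutral) (auto simp: indicator_def)
      then show ?thesis
        using \<tau> nonneg by simp
    qed
  qed
  finally show ?thesis .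
qed

lemma radial_direction:
  fixes x :: "'a::euclidean_space"
  obtains e where "norm e = 1" "x = norm x *\<^sub>R e"
proof (cases "x = 0")
  case True
  obtain i :: 'a where "i \<in> Basis"
    using nonempty_Basis by blast
  then show ?thesis
    using True that[of i] by simp
next
  case False
  then show ?thesis
    using that[of "x /\<^sub>R norm x"] by simp
qed

text \<open>The directions within \<beta> / (4 t) of -x / |x| form a cap of measure at least of
  order (\<beta> / t) ^ (n - 1), and each of them satisfies \<open>cone_line_integral_ge\<close>. A
  whole finite family of strips is carried along because in the critical case all of them
  contribute.\<close>

lemma Nop_ge_characteristic:
  assumes dim: "DIM('a::euclidean_space) \<ge> 3"
  obtains c where "c > 0" and
    "\<And>(G :: 'a \<times> real \<Rightarrow> real) x t \<beta> (J::nat set) a b g.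
      continuous_on (UNIV \<times> {0..t}) G \<Longrightarrow> (\<And>z. 0 \<le> G z) \<Longrightarrow> \<beta> = t - norm x \<Longrightarrow> 0 < \<beta> \<Longrightarrow>
      finite J \<Longrightarrow> (\<And>j. j \<in> J \<Longrightarrow> 0 \<le> a j \<and> a j \<le> b j \<and> b j \<le> \<beta> / 2 \<and> 0 \<le> g j) \<Longrightarrow>
      (\<And>y \<tau>. 0 \<le> \<tau> \<Longrightarrow> \<tau> \<le> \<beta> \<Longrightarrow>
        (\<Sum>j\<in>J. g j * indicator {a j..b j} (\<tau> - norm y)) \<le> G (y, \<tau>)) \<Longrightarrow>
      c * (t * (\<beta> / t) ^ (DIM('a) - 1)) * (\<Sum>j\<in>J. g j * (b j - a j)) \<le> Nop G (x, t)"
proof -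
  let ?n = "DIM('a)"
  obtain c0 where c0: "c0 > 0" and cap: "\<And>(e::'a) \<rho>. norm e = 1 \<Longrightarrow> 0 < \<rho> \<Longrightarrow> \<rho> \<le> 1 \<Longrightarrow>
     c0 * \<rho> ^ (?n - 1) \<le> measure lborel {y \<in> cball 0 1. norm (y /\<^sub>R norm y - e) \<le> \<rho>}"
    using measure_cap_ge by blast
  define d where "d = real ?n / ((real ?n - 2) * omega_n ?n)"
  define c where "c = d * c0 / (16 * 4 ^ (?n - 1))"
  have d: "0 < d"
    using dim omega_n_pos[of ?n] by (simp add: d_def)
  then have "c > 0"
    using c0 by (simp add: c_def)
  moreover have "c * (t * (\<beta> / t) ^ (?n - 1)) * (\<Sum>j\<in>J. g j * (b j - a j)) \<le> Nop G (x, t)"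
    if G: "continuous_on (UNIV \<times> {0..t}) G" "\<And>z. 0 \<le> G z" and \<beta>: "\<beta> = t - norm x" "0 < \<beta>"
      and J: "finite J" "\<And>j. j \<in> J \<Longrightarrow> 0 \<le> a j \<and> a j \<le> b j \<and> b j \<le> \<beta> / 2 \<and> 0 \<le> g j"
      and lower: "\<And>y \<tau>. 0 \<le> \<tau> \<Longrightarrow> \<tau> \<le> \<beta> \<Longrightarrow>
        (\<Sum>j\<in>J. g j * indicator {a j..b j} (\<tau> - norm y)) \<le> G (y, \<tau>)"
    for G :: "'a \<times> real \<Rightarrow> real" and x t \<beta> and J :: "nat set" and a b g
  proof -
    obtain e where e: "norm e = 1" "x = norm x *\<^sub>R e"
      by (rule radial_direction)
    have t: "0 < t" "\<beta> \<le> t"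
      using \<beta> by (smt (verit) norm_ge_zero)+
    define \<rho> where "\<rho> = \<beta> / (4 * t)"
    have \<rho>: "0 < \<rho>" "\<rho> < 1"
      using t \<beta>(2) by (simp_all add: \<rho>_def)
    define D where "D = {y \<in> cball 0 1. norm (y /\<^sub>R norm y - (- e)) \<le> \<rho>}"
    define S where "S = (\<Sum>j\<in>J. g j * (b j - a j))"
    have S: "0 \<le> S"
      unfolding S_def using J by (intro sum_nonneg) auto
    have Dm: "D \<in> sets borel"
      unfolding D_def by measurable
    have "d * measure lborel D * (t / 16 * S) \<le> Nop G (x, t)"
      unfolding d_def
    proof (rule Nop_ge[OF dim _ G Dm])
      show "D \<subseteq> cball 0 1" "0 \<le> t"
        using t by (auto simp: D_def)
      fix y assume y: "y \<in> D"
      \<comment> \<open>For y = 0 the normalised vector is 0, at distance 1 > \<rho> from -e, so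
        \<open>D\<close> contains genuine directions only.\<close>
      have "y \<noteq> 0"
        using y \<rho> e by (auto simp: D_def)
      then have y1: "norm (y /\<^sub>R norm y) = 1"
        by simp
      have "norm (y /\<^sub>R norm y + e) \<le> \<rho>"
        using y by (simp add: D_def)
      then have "t * norm (y /\<^sub>R norm y + e) \<le> t * \<rho>"
        using t by (intro mult_left_mono) auto
      then have "t * norm (y /\<^sub>R norm y + e) \<le> \<beta> / 4"
        using t by (simp add: \<rho>_def)
      then show "t / 16 * S \<le> (LINT \<tau>:{0..t}|lborel. (t - \<tau>) * G (x + (t - \<tau>) *\<^sub>R (y /\<^sub>R norm y), \<tau>))"
        unfolding S_def by (intro cone_line_integral_ge[OF G y1 e \<beta> _ J lower])
    qed
    moreover have "d * (c0 * \<rho> ^ (?n - 1)) * (t / 16 * S) \<le> d * measure lborel D * (t / 16 * S)"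
      using cap[of "- e" \<rho>] \<rho> e d t S unfolding D_def by (intro mult_right_mono mult_left_mono) auto
    moreover have "d * (c0 * \<rho> ^ (?n - 1)) * (t / 16 * S) = c * (t * (\<beta> / t) ^ (?n - 1)) * S"
    proof -
      have "\<rho> ^ (?n - 1) = (\<beta> / t) ^ (?n - 1) / 4 ^ (?n - 1)"
        by (simp add: \<rho>_def power_divide power_mult_distrib)
      then show ?thesis
        by (simp add: c_def mult_ac)
    qed
    ultimately show ?thesis
      unfolding S_def[symmetric] by linarith
  qed
  ultimately show ?thesis
    by (rule that)
qed

text \<open>Here every direction is used, but only the times in [s, (s + t) / 2]: there the weight t
  - \<tau> is at least (t - s) / 2, which yields a quarter of (t - s)^2.\<close>

lemma Nop_ge_cone:
  assumes dim: "DIM('a::euclidean_space) \<ge> 3"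
  obtains d where "d > 0" and
    "\<And>(G :: 'a \<times> real \<Rightarrow> real) x s t M.
      0 \<le> s \<Longrightarrow> s \<le> t \<Longrightarrow> continuous_on (UNIV \<times> {0..t}) G \<Longrightarrow> (\<And>z. 0 \<le> G z) \<Longrightarrow> 0 \<le> M \<Longrightarrow>
      (\<And>y \<tau>. s \<le> \<tau> \<Longrightarrow> \<tau> \<le> t \<Longrightarrow> norm (y - x) \<le> t - \<tau> \<Longrightarrow> M \<le> G (y, \<tau>)) \<Longrightarrow>
      d * M * (t - s)\<^sup>2 \<le> Nop G (x, t)"
proof -
  let ?n = "DIM('a)"
  define D where "D = cball (0::'a) 1"
  have D: "0 < measure lborel D"
    by (simp add: D_def content_cball)
  define d where "d = real ?n / ((real ?n - 2) * omega_n ?n) * measure lborel D / 4"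
  have "0 < d"
    using dim omega_n_pos[of ?n] D by (simp add: d_def)
  moreover have "d * M * (t - s)\<^sup>2 \<le> Nop G (x, t)"
    if st: "0 \<le> s" "s \<le> t" and G: "continuous_on (UNIV \<times> {0..t}) G" "\<And>z. 0 \<le> G z" and M: "0 \<le> M"
      and lower: "\<And>y \<tau>. s \<le> \<tau> \<Longrightarrow> \<tau> \<le> t \<Longrightarrow> norm (y - x) \<le> t - \<tau> \<Longrightarrow> M \<le> G (y, \<tau>)"
    for G :: "'a \<times> real \<Rightarrow> real" and x s t M
  proof -
    have "real ?n / ((real ?n - 2) * omega_n ?n) * measure lborel D * (M * (t - s)\<^sup>2 / 4) \<le> Nop G (x, t)"
    proof (rule Nop_ge[OF dim _ G])
      fix y assume "y \<in> D"
      define \<omega> where "\<omega> = y /\<^sub>R norm y"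
      \<comment> \<open>Only an inequality, because y = 0 gives \<omega> = 0; it suffices for
        staying in the backward cone.\<close>
      have \<omega>: "norm \<omega> \<le> 1"
        by (cases "y = 0") (auto simp: \<omega>_def)
      let ?h = "(s + t) / 2"
      have restrict: "indicator {0..t} \<tau> *\<^sub>R ((t - s) / 2 * M * indicator {s..?h} \<tau>)
          = (t - s) / 2 * M * indicator {s..?h} \<tau>" for \<tau>
        using st by (auto simp: indicator_def)
      have "M * (t - s)\<^sup>2 / 4 = (LINT \<tau>|lborel. (t - s) / 2 * M * indicator {s..?h} \<tau>)"
        using st by (simp add: power2_eq_square field_simps)
      also have "\<dots> = (LINT \<tau>:{0..t}|lborel. (t - s) / 2 * M * indicator {s..?h} \<tau>)"
        by (simp only: set_lebesgue_integral_def restrict)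
      also have "\<dots> \<le> (LINT \<tau>:{0..t}|lborel. (t - \<tau>) * G (x + (t - \<tau>) *\<^sub>R \<omega>, \<tau>))"
      proof (rule set_integral_mono)
        show "set_integrable lborel {0..t} (\<lambda>\<tau>. (t - s) / 2 * M * indicator {s..?h} \<tau>)"
          unfolding set_integrable_def restrict
          by (intro integrable_mult_right integrable_real_indicator) (auto simp: emeasure_lborel_Icc_eq)
        show "set_integrable lborel {0..t} (\<lambda>\<tau>. (t - \<tau>) * G (x + (t - \<tau>) *\<^sub>R \<omega>, \<tau>))"
          by (intro borel_integrable_atLeastAtMost' continuous_intros continuous_on_compose2[OF G(1)]) auto
        fix \<tau> assume \<tau>: "\<tau> \<in> {0..t}"
        have "(t - s) / 2 * M \<le> (t - \<tau>) * G (x + (t - \<tau>) *\<^sub>R \<omega>, \<tau>)" if "\<tau> \<in> {s..?h}"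
        proof (intro mult_mono lower)
          have "(t - \<tau>) * norm \<omega> \<le> (t - \<tau>) * 1"
            using \<omega> \<tau> by (intro mult_left_mono) auto
          then show "norm (x + (t - \<tau>) *\<^sub>R \<omega> - x) \<le> t - \<tau>"
            using \<tau> by simp
        qed (use that st \<tau> M in \<open>auto simp: field_simps\<close>)
        then show "(t - s) / 2 * M * indicator {s..?h} \<tau> \<le> (t - \<tau>) * G (x + (t - \<tau>) *\<^sub>R \<omega>, \<tau>)"
          using \<tau> G(2) by (auto simp: indicator_def)
      qed
      finally show "M * (t - s)\<^sup>2 / 4 \<le> (LINT \<tau>:{0..t}|lborel. (t - \<tau>) * G (x + (t - \<tau>) *\<^sub>R (y /\<^sub>R norm y), \<tau>))"
        by (simp add: \<omega>_def)
    qed (use st in \<open>auto simp: D_def\<close>)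
    then show ?thesis
      by (simp add: d_def mult_ac)
  qed
  ultimately show ?thesis
    by (rule that)
qed

section \<open>Blow-up on a backward cone\<close>

text \<open>If the product were too large, \<open>Nop_ge_cone\<close> applied on cones with common
  vertex (0, T) and successively halved heights would multiply the lower bound by a fixed \<mu> > 1
  each time, and the single number U (0, T) would exceed every bound.\<close>

lemma backward_cone_bound:
  assumes dim: "DIM('a::euclidean_space) \<ge> 3" and p: "p > 1"
  obtains C where "C > 0" and
    "\<And>(U :: 'a \<times> real \<Rightarrow> real) S T A.
      0 \<le> S \<Longrightarrow> S \<le> T \<Longrightarrow> continuous_on (UNIV \<times> {0..T}) U \<Longrightarrow> 0 < A \<Longrightarrow>
      (\<And>x t. S \<le> t \<Longrightarrow> t \<le> T \<Longrightarrow> norm x \<le> T - t \<Longrightarrow>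
        A \<le> U (x, t) \<and> Nop (\<lambda>z. \<bar>U z\<bar> powr p) (x, t) \<le> U (x, t)) \<Longrightarrow>
      A powr (p - 1) * (T - S)\<^sup>2 < C"
proof -
  obtain d where d: "d > 0" and Nop: "\<And>(G :: 'a \<times> real \<Rightarrow> real) x s t M.
      0 \<le> s \<Longrightarrow> s \<le> t \<Longrightarrow> continuous_on (UNIV \<times> {0..t}) G \<Longrightarrow> (\<And>z. 0 \<le> G z) \<Longrightarrow> 0 \<le> M \<Longrightarrow>
      (\<And>y \<tau>. s \<le> \<tau> \<Longrightarrow> \<tau> \<le> t \<Longrightarrow> norm (y - x) \<le> t - \<tau> \<Longrightarrow> M \<le> G (y, \<tau>)) \<Longrightarrow>
      d * M * (t - s)\<^sup>2 \<le> Nop G (x, t)"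
    using Nop_ge_cone[OF dim] by metis
  \<comment> \<open>With \<mu> powr (p - 1) = 4 the superlinear gain exactly balances the factor 4
    lost when the height is halved and then squared.\<close>
  define \<mu> where "\<mu> = (4::real) powr (1 / (p - 1))"
  have \<mu>: "1 < \<mu>"
    using p unfolding \<mu>_def by simp
  have \<mu>p: "(\<mu> ^ j) powr (p - 1) = 4 ^ j" for j
  proof -
    have "\<mu> powr (p - 1) = 4"
      using p by (simp add: \<mu>_def powr_powr)
    moreover have "(\<mu> ^ j) powr (p - 1) = (\<mu> powr (p - 1)) ^ j"
      using \<mu> by (induction j) (auto simp: powr_mult)
    ultimately show ?thesis
      by simp
  qed
  define C where "C = 4 * \<mu> / d"
  have "C > 0"
    using d \<mu> by (simp add: C_def)
  moreover have "A powr (p - 1) * (T - S)\<^sup>2 < C"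
    if ST: "0 \<le> S" "S \<le> T" and U: "continuous_on (UNIV \<times> {0..T}) U" and A: "0 < A"
      and lower: "\<And>x t. S \<le> t \<Longrightarrow> t \<le> T \<Longrightarrow> norm x \<le> T - t \<Longrightarrow>
        A \<le> U (x, t) \<and> Nop (\<lambda>z. \<bar>U z\<bar> powr p) (x, t) \<le> U (x, t)"
    for U :: "'a \<times> real \<Rightarrow> real" and S T A
  proof (rule ccontr)
    assume "\<not> A powr (p - 1) * (T - S)\<^sup>2 < C"
    then have large: "\<mu> \<le> d * A powr (p - 1) * (T - S)\<^sup>2 / 4"
      using d by (simp add: C_def field_simps)
    \<comment> \<open>The j-th cone starts at time \<open>s j\<close> and has height (T - S) / 2 ^
      j. A point of the next cone still has a time span of at least (T - S) / 2 ^ Suc j above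
      \<open>s j\<close> to integrate over.\<close>
    define s where "s j = T - (T - S) / 2 ^ j" for j :: nat
    have s_Suc: "s (Suc j) - s j = (T - S) / 2 ^ Suc j" for j
      by (simp add: s_def field_simps)
    have s0: "S \<le> s j" for j
    proof -
      have "(T - S) / 2 ^ j \<le> (T - S) / 1"
        using ST by (intro divide_left_mono) auto
      then show ?thesis
        by (simp add: s_def)
    qed
    have "\<forall>x t. s j \<le> t \<longrightarrow> t \<le> T \<longrightarrow> norm x \<le> T - t \<longrightarrow> A * \<mu> ^ j \<le> U (x, t)" for j
    proof (induction j)
      case 0
      then show ?case
        using lower by (auto simp: s_def)
    next
      case (Suc j)
      show ?case
      proof (intro allI impI)
        fix x :: 'a and t
        assume t: "s (Suc j) \<le> t" "t \<le> T" and x: "norm x \<le> T - t"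
        have h: "0 \<le> (T - S) / 2 ^ Suc j" "(T - S) / 2 ^ Suc j \<le> t - s j"
          using t s_Suc[of j] ST by auto
        then have sj: "s j \<le> t"
          by linarith
        have Aj: "0 < A * \<mu> ^ j"
          using A \<mu> by simp
        have "A * \<mu> ^ Suc j = A * \<mu> ^ j * \<mu>"
          by simp
        also have "\<dots> \<le> A * \<mu> ^ j * (d * A powr (p - 1) * (T - S)\<^sup>2 / 4)"
          using large Aj by (intro mult_left_mono) auto
        also have "\<dots> = d * (A * \<mu> ^ j) powr p * ((T - S) / 2 ^ Suc j)\<^sup>2"
        proof -
          have "(A * \<mu> ^ j) powr p = (A * \<mu> ^ j) powr (1 + (p - 1))"
            by simp
          also have "\<dots> = A * \<mu> ^ j * (A powr (p - 1) * 4 ^ j)"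
            unfolding powr_add using A \<mu> by (simp add: powr_mult \<mu>p)
          finally have 1: "(A * \<mu> ^ j) powr p = A * \<mu> ^ j * (A powr (p - 1) * 4 ^ j)" .
          have "((2::real) ^ Suc j)\<^sup>2 = 4 * 4 ^ j"
            by (simp add: power2_eq_square flip: power_mult_distrib)
          then show ?thesis
            unfolding 1 by (simp add: power_divide)
        qed
        also have "\<dots> \<le> d * (A * \<mu> ^ j) powr p * (t - s j)\<^sup>2"
          using d h by (intro mult_left_mono power_mono) auto
        also have "\<dots> \<le> Nop (\<lambda>z. \<bar>U z\<bar> powr p) (x, t)"
        proof (rule Nop)
          show "0 \<le> s j"
            using s0[of j] ST by linarith
          show "continuous_on (UNIV \<times> {0..t}) (\<lambda>z. \<bar>U z\<bar> powr p)"
            using p t by (intro continuous_on_powr' continuous_intros continuous_on_subset[OF U]) auto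
          fix y :: 'a and \<tau>
          assume \<tau>: "s j \<le> \<tau>" "\<tau> \<le> t" and y: "norm (y - x) \<le> t - \<tau>"
          have "norm y \<le> T - \<tau>"
            using norm_triangle_sub[of y x] x y by linarith
          then have "A * \<mu> ^ j \<le> U (y, \<tau>)"
            using Suc \<tau> t by auto
          then show "(A * \<mu> ^ j) powr p \<le> \<bar>U (y, \<tau>)\<bar> powr p"
            using Aj p by (intro powr_mono2) auto
        qed (use sj in auto)
        also have "\<dots> \<le> U (x, t)"
          using lower[of t x] x t s0[of "Suc j"] by auto
        finally show "A * \<mu> ^ Suc j \<le> U (x, t)" .
      qed
    qed
    moreover have "s j \<le> T" for j
      using ST by (simp add: s_def)
    ultimately have "A * \<mu> ^ j \<le> U (0, T)" for j
      by simp
    moreover obtain j where "U (0, T) / A < \<mu> ^ j"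
      using \<mu> real_arch_pow by blast
    ultimately show False
      using A by (smt (verit) divide_less_eq mult.commute)
  qed
  ultimately show ?thesis
    by (rule that)
qed

section \<open>The free part for f = 0\<close>

text \<open>For f = 0 the free part is t times a spherical mean of h, so when h is nonnegative on
  the sphere the directions in \<open>D\<close> alone give a lower bound. The point y = 0 stands for
  no direction and is discarded as a null set.\<close>

lemma Vfree_zero_ge:
  fixes h :: "'a::euclidean_space \<Rightarrow> real" and x :: 'a
  assumes t: "0 \<le> t" and cont: "continuous_on UNIV h"
    and nonneg: "\<And>z. norm (z - x) = t \<Longrightarrow> 0 \<le> h z"
    and D: "D \<in> sets borel" "D \<subseteq> cball 0 1"
    and M: "0 \<le> M" "\<And>y. y \<in> D \<Longrightarrow> y \<noteq> 0 \<Longrightarrow> M \<le> h (x + t *\<^sub>R (y /\<^sub>R norm y))"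
  shows "real DIM('a) / omega_n DIM('a) * measure lborel D * (t * M) \<le> Vfree (\<lambda>_. 0) h (x, t)"
proof -
  have n: "1 \<le> DIM('a)"
    using DIM_positive[where 'a = 'a] by linarith
  define H where "H y = h (x + t *\<^sub>R (y /\<^sub>R norm y))" for y :: 'a
  have hm [measurable]: "h \<in> borel_measurable borel"
    by (rule borel_measurable_continuous_onI[OF cont])
  have [measurable]: "cball (0::'a) 1 \<in> sets borel"
    by simp
  have "compact (h ` cball x t)"
    by (intro compact_continuous_image continuous_on_subset[OF cont]) auto
  then have "bounded (h ` cball x t)"
    by (rule compact_imp_bounded)
  then obtain K where K: "\<And>z. z \<in> cball x t \<Longrightarrow> \<bar>h z\<bar> \<le> K"
    unfolding bounded_iff by (auto simp del: mem_cball)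
  have Hint: "integrable lborel (\<lambda>y. indicator (cball 0 1) y * H y)"
  proof (rule integrableI_bounded_set)
    show "cball 0 1 \<in> sets (lborel :: 'a measure)"
      by simp
    show "(\<lambda>y. indicator (cball 0 1) y * H y) \<in> borel_measurable lborel"
      unfolding H_def by measurable
    show "emeasure lborel (cball (0::'a) 1) < \<infinity>"
      by (intro emeasure_bounded_finite) auto
    show "AE y\<in>cball 0 1 in lborel. norm (indicator (cball 0 1) y * H y) \<le> K"
    proof (intro AE_I2 impI)
      fix y :: 'a assume y: "y \<in> cball 0 1"
      have "norm (t *\<^sub>R (y /\<^sub>R norm y)) \<le> t * 1"
        unfolding norm_scaleR[of t] using t by (intro mult_mono) (auto simp: field_simps)
      then have "\<bar>h (x + t *\<^sub>R (y /\<^sub>R norm y))\<bar> \<le> K"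
        using t by (intro K) (auto simp: dist_norm)
      then show "norm (indicator (cball 0 1) y * H y) \<le> K"
        using y by (simp add: H_def)
    qed
    show "AE y in lborel. y \<notin> cball 0 1 \<longrightarrow> indicator (cball 0 1) y * H y = 0"
      by (auto simp: indicator_def)
  qed
  have fin: "emeasure lborel D < \<infinity>"
    using D by (intro emeasure_bounded_finite bounded_subset[OF bounded_cball]) auto
  have "measure lborel D * M = (LINT y|lborel. indicator D y * M)"
    using D by simp
  also have "\<dots> \<le> (LINT y|lborel. indicator (cball 0 1) y * H y)"
  proof (rule integral_mono_AE[OF _ Hint])
    show "integrable lborel (\<lambda>y. indicator D y * M)"
      using D fin by (intro integrable_mult_left integrable_real_indicator) auto
    have "AE y in lborel. y \<noteq> (0::'a)"
      by (rule AE_lborel_singleton)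
    then show "AE y in lborel. indicator D y * M \<le> indicator (cball 0 1) y * H y"
    proof eventually_elim
      case (elim y)
      have "0 \<le> h (x + t *\<^sub>R (y /\<^sub>R norm y))"
        using elim t by (intro nonneg) simp
      then show ?case
        using M(2)[of y] elim D by (auto simp: H_def indicator_def)
    qed
  qed
  finally have "t * (measure lborel D * M) \<le> t * (LINT y|lborel. indicator (cball 0 1) y * H y)"
    by (rule mult_left_mono[OF _ t])
  then have "real DIM('a) / omega_n DIM('a) * (t * (measure lborel D * M))
      \<le> real DIM('a) / omega_n DIM('a) * (t * (LINT y|lborel. indicator (cball 0 1) y * H y))"
    by (rule mult_left_mono) (use omega_n_pos[OF n] in auto)
  moreover have "Vfree (\<lambda>_. 0) h (x, t)
      = real DIM('a) / omega_n DIM('a) * (t * (LINT y|lborel. indicator (cball 0 1) y * H y))"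
  proof -
    have "(LINT y|lborel. indicator (cball 0 1) y *\<^sub>R (t * h (x + t *\<^sub>R (y /\<^sub>R norm y))))
        = (LINT y|lborel. t * (indicator (cball 0 1) y * H y))"
      by (intro Bochner_Integration.integral_cong refl) (simp add: H_def)
    then show ?thesis
      by (simp add: Vfree_def sphere_int_def set_lebesgue_integral_def H_def)
  qed
  ultimately show ?thesis
    by (simp add: mult_ac)
qed

lemma Vfree_zero_eq_0:
  fixes h :: "'a::euclidean_space \<Rightarrow> real" and x :: 'a
  assumes t: "0 \<le> t" and zero: "\<And>z. norm (z - x) = t \<Longrightarrow> h z = 0"
  shows "Vfree (\<lambda>_. 0) h (x, t) = 0"
proof -
  have "AE y in lborel. indicator (cball 0 1) y *\<^sub>R h (x + t *\<^sub>R (y /\<^sub>R norm y)) = 0"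
    using AE_lborel_singleton[of "0::'a"]
  proof eventually_elim
    case (elim y)
    then show ?case
      using t zero[of "x + t *\<^sub>R (y /\<^sub>R norm y)"] by simp
  qed
  then have "(LINT y|lborel. indicator (cball 0 1) y *\<^sub>R h (x + t *\<^sub>R (y /\<^sub>R norm y))) = 0"
    by (rule integral_eq_zero_AE)
  then show ?thesis
    by (simp add: Vfree_def sphere_int_def set_lebesgue_integral_def)
qed

text \<open>For a \<le> t - |x| \<le> b the sphere of radius t about x stays in |z| > k0, where the
  data are nonnegative, and around its point closest to the origin it runs through the shell of
  positive data. The cap in question has radius of order 1 / t, hence measure at least of order t ^
  (1 - n); the factor t of the free part turns this into t ^ (2 - n).\<close>

lemma Vfree_radial_bounds:
  fixes g0 :: "real \<Rightarrow> real"
  assumes dim: "DIM('a::euclidean_space) \<ge> 3"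
    and cont: "continuous_on {0..} g0"
    and supp: "\<forall>r\<ge>0. r > k \<longrightarrow> g0 r = 0"
    and k0: "0 < k0" "k0 < k"
    and pos: "\<forall>r. k0 < r \<and> r < k \<longrightarrow> g0 r > 0"
  obtains a b v where "0 < a" "a < b" "b < k" "0 < v"
    and "\<And>(x::'a) t. a \<le> t - norm x \<Longrightarrow> t - norm x \<le> b \<Longrightarrow>
      v * t powr - (real DIM('a) - 2) \<le> Vfree (\<lambda>_. 0) (\<lambda>x. g0 (norm x)) (x, t)"
proof -
  let ?n = "DIM('a)"
  let ?h = "\<lambda>x::'a. g0 (norm x)"
  have h: "continuous_on UNIV ?h"
    by (rule continuous_on_compose2[OF cont]) (auto intro: continuous_intros)
  define a where "a = k0 + (k - k0) / 4"
  define b where "b = k0 + (k - k0) / 2"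
  \<comment> \<open>\<open>b + \<delta> < k\<close> keeps the cap in the positive shell, and
    \<delta> \<le> a \<le> t makes its radius \<delta> / t at most 1.\<close>
  define \<delta> where "\<delta> = min a ((k - k0) / 4)"
  have ab: "0 < a" "k0 < a" "a < b" "b < k" "b + \<delta> < k" "0 < \<delta>" "\<delta> \<le> a"
    using k0 by (auto simp: a_def b_def \<delta>_def min_def field_simps)
  have "compact (g0 ` {a..b + \<delta>})" "g0 ` {a..b + \<delta>} \<noteq> {}"
    using ab by (auto intro!: compact_continuous_image continuous_on_subset[OF cont])
  then obtain M where M: "M \<in> g0 ` {a..b + \<delta>}" "\<And>r. r \<in> {a..b + \<delta>} \<Longrightarrow> M \<le> g0 r"
    using compact_attains_inf[of "g0 ` {a..b + \<delta>}"] by blast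
  have Mpos: "0 < M"
    using M(1) pos ab by auto
  \<comment> \<open>At r = k neither the support condition nor the positivity condition speaks; the
    value is a limit of zeros from the right.\<close>
  have "0 \<le> g0 k"
  proof -
    have "(g0 \<longlongrightarrow> g0 k) (at k within {0..})"
      using cont k0 by (auto simp: continuous_on_def)
    then have "(g0 \<longlongrightarrow> g0 k) (at_right k)"
      by (rule tendsto_within_subset) (use k0 in auto)
    moreover have "\<forall>\<^sub>F r in at_right k. g0 r \<ge> 0"
      using supp k0 by (auto simp: eventually_at_right_field intro!: exI[of _ "k + 1"])
    ultimately show ?thesis
      by (intro tendsto_lowerbound) auto
  qed
  then have g_nonneg: "0 \<le> g0 r" if "k0 < r" for r
    using that supp pos k0 by (cases r k rule: linorder_cases) auto
  obtain c0 where c0: "c0 > 0" and cap: "\<And>(e::'a) \<rho>. norm e = 1 \<Longrightarrow> 0 < \<rho> \<Longrightarrow> \<rho> \<le> 1 \<Longrightarrow>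
     c0 * \<rho> ^ (?n - 1) \<le> measure lborel {y \<in> cball 0 1. norm (y /\<^sub>R norm y - e) \<le> \<rho>}"
    using measure_cap_ge by blast
  define d where "d = real ?n / omega_n ?n"
  have d: "0 < d"
    using dim omega_n_pos[of ?n] by (simp add: d_def)
  define v where "v = d * c0 * M * \<delta> ^ (?n - 1)"
  have "0 < v"
    using d c0 Mpos ab by (simp add: v_def)
  moreover have "v * t powr - (real ?n - 2) \<le> Vfree (\<lambda>_. 0) ?h (x, t)"
    if tx: "a \<le> t - norm x" "t - norm x \<le> b" for x :: 'a and t
  proof -
    obtain e where e: "norm e = 1" "x = norm x *\<^sub>R e"
      by (rule radial_direction)
    have t: "0 < t" "\<delta> \<le> t"
      using tx ab norm_ge_zero[of x] by linarith+
    define \<rho> where "\<rho> = \<delta> / t"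
    have \<rho>: "0 < \<rho>" "\<rho> \<le> 1"
      using t ab by (auto simp: \<rho>_def)
    define D where "D = {y \<in> cball 0 1. norm (y /\<^sub>R norm y - (- e)) \<le> \<rho>}"
    have sphere: "t - norm x \<le> norm z" if "norm (z - x) = t" for z
      using that norm_triangle_sub[of "z - x" z] by simp
    have "d * measure lborel D * (t * M) \<le> Vfree (\<lambda>_. 0) ?h (x, t)"
      unfolding d_def
    proof (rule Vfree_zero_ge[OF _ h])
      show "0 \<le> g0 (norm z)" if "norm (z - x) = t" for z
        using sphere[OF that] tx ab by (intro g_nonneg) linarith
      show "D \<in> sets borel"
        unfolding D_def by measurable
      fix y assume y: "y \<in> D" "y \<noteq> 0"
      define \<omega> where "\<omega> = y /\<^sub>R norm y"
      have \<omega>: "norm \<omega> = 1" "norm (\<omega> + e) \<le> \<rho>"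
        using y by (auto simp: \<omega>_def D_def)
      have "x + t *\<^sub>R \<omega> = (norm x - t) *\<^sub>R e + t *\<^sub>R (\<omega> + e)"
        using e by (simp add: algebra_simps)
      then have "norm (x + t *\<^sub>R \<omega>) \<le> norm ((norm x - t) *\<^sub>R e) + norm (t *\<^sub>R (\<omega> + e))"
        by (metis norm_triangle_ineq)
      also have "\<dots> = (t - norm x) + t * norm (\<omega> + e)"
        using e t tx ab by simp
      also have "t * norm (\<omega> + e) \<le> t * \<rho>"
        using \<omega> t by (intro mult_left_mono) auto
      also have "t * \<rho> = \<delta>"
        using t by (simp add: \<rho>_def)
      finally have "norm (x + t *\<^sub>R \<omega>) \<le> b + \<delta>"
        using tx by simp
      moreover have "t - norm x \<le> norm (x + t *\<^sub>R \<omega>)"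
        using \<omega> t by (intro sphere) simp
      ultimately show "M \<le> g0 (norm (x + t *\<^sub>R (y /\<^sub>R norm y)))"
        using tx unfolding \<omega>_def[symmetric] by (intro M(2)) auto
    qed (use t Mpos in \<open>auto simp: D_def\<close>)
    moreover have "d * (c0 * \<rho> ^ (?n - 1)) * (t * M) \<le> d * measure lborel D * (t * M)"
      using cap[of "- e" \<rho>] \<rho> e d t Mpos unfolding D_def by (intro mult_right_mono mult_left_mono) auto
    moreover have "d * (c0 * \<rho> ^ (?n - 1)) * (t * M) = v * t powr - (real ?n - 2)"
    proof -
      have "t powr (1 - real N) = t / t ^ N" for N
        using t by (simp add: powr_diff powr_realpow)
      moreover have "- (real ?n - 2) = 1 - real (?n - 1)"
        using dim by (simp add: of_nat_diff)
      ultimately have "t powr - (real ?n - 2) = t / t ^ (?n - 1)"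
        by metis
      then show ?thesis
        by (simp add: v_def \<rho>_def power_divide)
    qed
    ultimately show ?thesis
      by linarith
  qed
  ultimately show ?thesis
    using ab that[of a b v] by blast
qed

section \<open>The homogeneous profile: blow-up criterion and improvement\<close>

text \<open>This is the shape that \<open>Nop\<close> produces from a bound of order t powr (2 - n)
  on a strip. It is homogeneous of degree d = 1 - (n - 2) p in (x, t), and 2 + (p - 1) d = zeta p n
  / 2, the power of T in the blow-up criterion. The iteration improves the coefficient
  \<kappa>.\<close>

definition profile_bound :: "real \<Rightarrow> real \<Rightarrow> real \<Rightarrow> real \<Rightarrow> ('a::euclidean_space \<times> real \<Rightarrow> real) \<Rightarrow> bool" where
  "profile_bound p T B \<kappa> U \<longleftrightarrow> (\<forall>x t. t \<le> T \<longrightarrow> B \<le> t - norm x \<longrightarrow>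
     \<kappa> * t powr - (real DIM('a) - 2) * (t - norm x) powr (real DIM('a) - 1 - (real DIM('a) - 2) * p) \<le> U (x, t))"

text \<open>On the backward cone with vertex (0, T) and height T / 3 both t and t - |x| lie between
  T / 3 and T, so the profile is at least a constant multiple of its value at scale T and
  \<open>backward_cone_bound\<close> applies. The condition 3 * B \<le> T places this cone in the
  range t - |x| \<ge> B.\<close>

lemma profile_bound_blowup:
  assumes dim: "DIM('a::euclidean_space) \<ge> 3" and p: "p > 1"
  obtains C where "C > 0" and
    "\<And>(U :: 'a \<times> real \<Rightarrow> real) T B \<kappa>.
      0 < B \<Longrightarrow> 3 * B \<le> T \<Longrightarrow> 0 < \<kappa> \<Longrightarrow> continuous_on (UNIV \<times> {0..T}) U \<Longrightarrow> profile_bound p T B \<kappa> U \<Longrightarrow>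
      (\<And>x t. t \<le> T \<Longrightarrow> B \<le> t - norm x \<Longrightarrow> Nop (\<lambda>z. \<bar>U z\<bar> powr p) (x, t) \<le> U (x, t)) \<Longrightarrow>
      \<kappa> powr (p - 1) * T powr (zeta p (real DIM('a)) / 2) < C"
proof -
  define m where "m = real DIM('a) - 2"
  define q where "q = m * p - (m + 1)"
  have profile_iff: "profile_bound p T B \<kappa> U \<longleftrightarrow>
      (\<forall>x t. t \<le> T \<longrightarrow> B \<le> t - norm x \<longrightarrow> \<kappa> * t powr - m * (t - norm x) powr - q \<le> U (x, t))"
    for T B \<kappa> and U :: "'a \<times> real \<Rightarrow> real"
  proof -
    have "real DIM('a) - 1 - (real DIM('a) - 2) * p = - q"
      by (simp add: q_def m_def)
    then show ?thesis
      unfolding profile_bound_def m_def by simp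
  qed
  obtain C0 where C0: "C0 > 0" and cone: "\<And>(U :: 'a \<times> real \<Rightarrow> real) S T A.
      0 \<le> S \<Longrightarrow> S \<le> T \<Longrightarrow> continuous_on (UNIV \<times> {0..T}) U \<Longrightarrow> 0 < A \<Longrightarrow>
      (\<And>x t. S \<le> t \<Longrightarrow> t \<le> T \<Longrightarrow> norm x \<le> T - t \<Longrightarrow>
        A \<le> U (x, t) \<and> Nop (\<lambda>z. \<bar>U z\<bar> powr p) (x, t) \<le> U (x, t)) \<Longrightarrow>
      A powr (p - 1) * (T - S)\<^sup>2 < C0"
    using backward_cone_bound[OF dim p] by metis
  \<comment> \<open>The sign of q is not fixed, so for T / 3 \<le> \<beta> \<le> T the powers
    \<beta> powr - q and T powr - q are compared through the exponent -|q|.\<close>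
  define w where "w = (3::real) powr - \<bar>q\<bar>"
  have w: "0 < w"
    by (simp add: w_def)
  define C where "C = 9 * C0 / w powr (p - 1)"
  have "C > 0"
    using C0 w by (simp add: C_def)
  moreover have "\<kappa> powr (p - 1) * T powr (zeta p (real DIM('a)) / 2) < C"
    if B: "0 < B" "3 * B \<le> T" and \<kappa>: "0 < \<kappa>" and U: "continuous_on (UNIV \<times> {0..T}) U"
      and profile: "profile_bound p T B \<kappa> U"
      and Nop: "\<And>x t. t \<le> T \<Longrightarrow> B \<le> t - norm x \<Longrightarrow> Nop (\<lambda>z. \<bar>U z\<bar> powr p) (x, t) \<le> U (x, t)"
    for U :: "'a \<times> real \<Rightarrow> real" and T B \<kappa>
  proof -
    have T: "0 < T"
      using B by linarith
    define A where "A = \<kappa> * T powr - m * (T powr - q * w)"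
    have "A powr (p - 1) * (T - 2 * T / 3)\<^sup>2 < C0"
    proof (rule cone[OF _ _ U])
      show "0 < A"
        using \<kappa> T w by (simp add: A_def)
      fix x :: 'a and t
      assume t: "2 * T / 3 \<le> t" "t \<le> T" and x: "norm x \<le> T - t"
      define \<beta> where "\<beta> = t - norm x"
      have \<beta>: "T / 3 \<le> \<beta>" "\<beta> \<le> T" "0 < \<beta>" "0 < t"
        using t x T norm_ge_zero[of x] unfolding \<beta>_def by linarith+
      have "T powr - q * w \<le> \<beta> powr - q"
      proof -
        have "1 \<le> T / \<beta>" "T / \<beta> \<le> 3"
          using \<beta> T by (simp_all add: field_simps)
        have "w \<le> (T / \<beta>) powr - \<bar>q\<bar>"
          unfolding w_def powr_minus using \<open>1 \<le> T / \<beta>\<close> \<open>T / \<beta> \<le> 3\<close>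
          by (intro le_imp_inverse_le powr_mono2) auto
        also have "\<dots> \<le> (T / \<beta>) powr q"
          using \<open>1 \<le> T / \<beta>\<close> by (intro powr_mono) auto
        finally have "T powr - q * w \<le> T powr - q * (T / \<beta>) powr q"
          by (intro mult_left_mono) auto
        also have "\<dots> = \<beta> powr - q"
          using T \<beta> by (simp add: powr_divide powr_minus field_simps)
        finally show ?thesis .
      qed
      moreover have "T powr - m \<le> t powr - m"
        using t \<beta> dim by (intro powr_mono2') (auto simp: m_def)
      ultimately have "A \<le> \<kappa> * t powr - m * \<beta> powr - q"
        unfolding A_def using \<kappa> w by (intro mult_mono) auto
      also have "\<dots> \<le> U (x, t)"
        using profile t \<beta> B unfolding profile_iff \<beta>_def by auto
      finally show "A \<le> U (x, t) \<and> Nop (\<lambda>z. \<bar>U z\<bar> powr p) (x, t) \<le> U (x, t)"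
        using Nop t \<beta> B by (auto simp: \<beta>_def)
    qed (use T in auto)
    moreover have "A powr (p - 1) * (T - 2 * T / 3)\<^sup>2
      = \<kappa> powr (p - 1) * T powr (zeta p (real DIM('a)) / 2) * w powr (p - 1) / 9"
    proof -
      \<comment> \<open>Scaling: the powers of T in \<open>A powr (p - 1)\<close> and the squared
        height of the cone add up to zeta / 2.\<close>
      have "zeta p (real DIM('a)) / 2 = - m * (p - 1) + - q * (p - 1) + 2"
        by (simp add: zeta_def q_def m_def field_simps power2_eq_square)
      then have "T powr (zeta p (real DIM('a)) / 2) = (T powr - m) powr (p - 1) * (T powr - q) powr (p - 1) * T\<^sup>2"
        using T by (simp only: powr_add powr_powr) simp
      moreover have "(T - 2 * T / 3)\<^sup>2 = T\<^sup>2 / 9"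
        by (simp add: power2_eq_square field_simps)
      ultimately show ?thesis
        unfolding A_def using \<kappa> T w by (simp add: powr_mult mult_ac)
    qed
    ultimately show ?thesis
      using w by (simp add: C_def field_simps)
  qed
  ultimately show ?thesis
    by (rule that)
qed

text \<open>The data strip [a, b] contributes (b - a) v^p. In the critical case the p-th power of
  the profile decays like 1 / (t - |x|) apart from its power of t, so the strip [B 4^j, 2 B 4^j]
  contributes l_j^p / 2 whatever its scale. For i = 0 only the data strip is present and zeta may be
  arbitrary.\<close>

lemma profile_bound_step:
  assumes dim: "DIM('a::euclidean_space) \<ge> 3" and p: "p > 1"
  obtains c where "c > 0" and
    "\<And>(U :: 'a \<times> real \<Rightarrow> real) T a b B v l i.
      continuous_on (UNIV \<times> {0..T}) U \<Longrightarrow> 0 < a \<Longrightarrow> a \<le> b \<Longrightarrow> 2 * b < B \<Longrightarrow> 0 \<le> v \<Longrightarrow>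
      (\<And>x t. t \<le> T \<Longrightarrow> B \<le> t - norm x \<Longrightarrow> Nop (\<lambda>z. \<bar>U z\<bar> powr p) (x, t) \<le> U (x, t)) \<Longrightarrow>
      (\<And>x t. t \<le> T \<Longrightarrow> a \<le> t - norm x \<Longrightarrow> t - norm x \<le> b \<Longrightarrow> v * t powr - (real DIM('a) - 2) \<le> U (x, t)) \<Longrightarrow>
      i = 0 \<or> zeta p (real DIM('a)) = 0 \<Longrightarrow>
      (\<And>j. j < i \<Longrightarrow> 0 \<le> l j \<and> profile_bound p T (B * 4 ^ j) (l j) U) \<Longrightarrow>
      profile_bound p T (B * 4 ^ i) (c * ((b - a) * v powr p + (\<Sum>j<i. l j powr p / 2))) U"
proof -
  define m where "m = real DIM('a) - 2"
  define q where "q = m * p - (m + 1)"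
  have profile_iff: "profile_bound p T B \<kappa> U \<longleftrightarrow>
      (\<forall>x t. t \<le> T \<longrightarrow> B \<le> t - norm x \<longrightarrow> \<kappa> * t powr - m * (t - norm x) powr - q \<le> U (x, t))"
    for T B \<kappa> and U :: "'a \<times> real \<Rightarrow> real"
  proof -
    have "real DIM('a) - 1 - (real DIM('a) - 2) * p = - q"
      by (simp add: q_def m_def)
    then show ?thesis
      unfolding profile_bound_def m_def by simp
  qed
  have m: "1 \<le> m"
    using dim by (simp add: m_def)
  obtain c where c: "c > 0" and Nop_ge: "\<And>(G :: 'a \<times> real \<Rightarrow> real) x t \<beta> (J::nat set) a b g.
      continuous_on (UNIV \<times> {0..t}) G \<Longrightarrow> (\<And>z. 0 \<le> G z) \<Longrightarrow> \<beta> = t - norm x \<Longrightarrow> 0 < \<beta> \<Longrightarrow>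
      finite J \<Longrightarrow> (\<And>j. j \<in> J \<Longrightarrow> 0 \<le> a j \<and> a j \<le> b j \<and> b j \<le> \<beta> / 2 \<and> 0 \<le> g j) \<Longrightarrow>
      (\<And>y \<tau>. 0 \<le> \<tau> \<Longrightarrow> \<tau> \<le> \<beta> \<Longrightarrow>
        (\<Sum>j\<in>J. g j * indicator {a j..b j} (\<tau> - norm y)) \<le> G (y, \<tau>)) \<Longrightarrow>
      c * (t * (\<beta> / t) ^ (DIM('a) - 1)) * (\<Sum>j\<in>J. g j * (b j - a j)) \<le> Nop G (x, t)"
  proof (rule Nop_ge_characteristic[OF dim], goal_cases)
    case (1 c)
    show ?case
      by (rule 1(1), fact 1(2), fact 1(3))
  qed
  have "profile_bound p T (B * 4 ^ i) (c * ((b - a) * v powr p + (\<Sum>j<i. l j powr p / 2))) U"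
    if U: "continuous_on (UNIV \<times> {0..T}) U" and ab: "0 < a" "a \<le> b" "2 * b < B" and v: "0 \<le> v"
      and Nop: "\<And>x t. t \<le> T \<Longrightarrow> B \<le> t - norm x \<Longrightarrow> Nop (\<lambda>z. \<bar>U z\<bar> powr p) (x, t) \<le> U (x, t)"
      and strip: "\<And>x t. t \<le> T \<Longrightarrow> a \<le> t - norm x \<Longrightarrow> t - norm x \<le> b \<Longrightarrow> v * t powr - (real DIM('a) - 2) \<le> U (x, t)"
      and crit: "i = 0 \<or> zeta p (real DIM('a)) = 0"
      and IH: "\<And>j. j < i \<Longrightarrow> 0 \<le> l j \<and> profile_bound p T (B * 4 ^ j) (l j) U"
    for U :: "'a \<times> real \<Rightarrow> real" and T a b B v l i
    unfolding profile_iff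
  proof (intro allI impI)
    fix x :: 'a and t
    assume t: "t \<le> T" and \<beta>B: "B * 4 ^ i \<le> t - norm x"
    define \<beta> where "\<beta> = t - norm x"
    have B: "0 < B"
      using ab by linarith
    have "B * 1 \<le> B * 4 ^ i"
      using B by (intro mult_left_mono) auto
    then have \<beta>: "B \<le> \<beta>" "0 < \<beta>" "0 < t" "\<beta> \<le> t"
      using B \<beta>B norm_ge_zero[of x] unfolding \<beta>_def by linarith+
    define G where "G = (\<lambda>z. \<bar>U z\<bar> powr p)"
    \<comment> \<open>Index 0 is the data strip, index j + 1 the strip at scale B * 4 ^ j. The
      heights \<open>g\<close> replace \<tau> by its largest value \<beta> and, on the later strips,
      \<tau> - |y| by its largest value 2 * (B * 4 ^ j).\<close>
    define lo where "lo j = (case j of 0 \<Rightarrow> a | Suc j \<Rightarrow> B * 4 ^ j)" for j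
    define hi where "hi j = (case j of 0 \<Rightarrow> b | Suc j \<Rightarrow> 2 * (B * 4 ^ j))" for j
    define g where "g j = (case j of 0 \<Rightarrow> v powr p * \<beta> powr (- m * p)
      | Suc j \<Rightarrow> l j powr p * \<beta> powr (- m * p) / (2 * (B * 4 ^ j)))" for j
    \<comment> \<open>zeta / 2 = 1 - q p, so criticality means q p = 1.\<close>
    have qp: "- q * p = - 1" "0 < q" if "i \<noteq> 0"
    proof -
      have "zeta p (real DIM('a)) = 0"
        using that crit by simp
      then show qp: "- q * p = - 1"
        by (simp add: zeta_def q_def m_def field_simps power2_eq_square)
      then have "q * p = 1"
        by simp
      then show "0 < q"
        using p zero_less_mult_pos2[of q p] by simp
    qed
    \<comment> \<open>Disjointness of the strips: at any point at most one term of the sum of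
      indicators survives.\<close>
    have gap: "hi j < lo j'" if jj: "j < j'" for j j'
    proof (cases j)
      case 0
      obtain k where k: "j' = Suc k"
        using jj by (cases j') auto
      have "B * 1 \<le> B * 4 ^ k"
        using B by (intro mult_left_mono) auto
      then have "b < B * 4 ^ k"
        using ab by linarith
      then show ?thesis
        using 0 k by (simp add: lo_def hi_def)
    next
      case (Suc h)
      obtain k where k: "j' = Suc k"
        using jj by (cases j') auto
      have "(4::real) ^ Suc h \<le> 4 ^ k"
        using jj Suc k by (intro power_increasing) auto
      then have "B * 4 ^ Suc h \<le> B * 4 ^ k"
        using B by (intro mult_left_mono) auto
      moreover have "0 < B * 4 ^ h"
        using B by simp
      ultimately show ?thesis
        using Suc k by (simp add: lo_def hi_def)
    qed
    have g_le: "g j \<le> G (y, \<tau>)"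
      if \<tau>: "0 \<le> \<tau>" "\<tau> \<le> \<beta>" and j: "j \<le> i" and in_j: "\<tau> - norm y \<in> {lo j..hi j}" for y \<tau> j
    proof (cases j)
      case 0
      have "0 < \<tau>"
      proof -
        have "a \<le> \<tau> - norm y"
          using in_j 0 by (simp add: lo_def)
        then show ?thesis
          using ab norm_ge_zero[of y] by linarith
      qed
      have "v * \<beta> powr - m \<le> v * \<tau> powr - m"
        using \<tau> \<open>0 < \<tau>\<close> m v by (intro mult_left_mono powr_mono2') auto
      also have "\<dots> \<le> U (y, \<tau>)"
        using strip[of \<tau> y] in_j 0 \<tau> \<beta> t by (simp add: lo_def hi_def m_def)
      finally have "(v * \<beta> powr - m) powr p \<le> \<bar>U (y, \<tau>)\<bar> powr p"
        using v p by (intro powr_mono2) auto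
      then show ?thesis
        using 0 v by (simp add: g_def G_def powr_mult powr_powr)
    next
      case (Suc k)
      then have k: "k < i"
        using j by simp
      then have i0: "i \<noteq> 0"
        by simp
      define \<sigma> where "\<sigma> = \<tau> - norm y"
      have \<sigma>: "B * 4 ^ k \<le> \<sigma>" "\<sigma> \<le> 2 * (B * 4 ^ k)"
        using in_j Suc by (simp_all add: lo_def hi_def \<sigma>_def)
      have Bk: "0 < B * 4 ^ k"
        using B by simp
      have "0 < \<tau>"
        using \<sigma> Bk norm_ge_zero[of y] unfolding \<sigma>_def by linarith
      have l: "0 \<le> l k"
        using IH k by blast
      have "l k * \<beta> powr - m * (2 * (B * 4 ^ k)) powr - q \<le> l k * \<tau> powr - m * \<sigma> powr - q"
        using \<tau> \<open>0 < \<tau>\<close> m l \<sigma> Bk qp(2)[OF i0] by (intro mult_mono powr_mono2') auto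
      also have "\<dots> \<le> U (y, \<tau>)"
        using IH[OF k] \<sigma> \<tau> \<beta> t unfolding profile_iff \<sigma>_def by auto
      finally have "(l k * \<beta> powr - m * (2 * (B * 4 ^ k)) powr - q) powr p \<le> \<bar>U (y, \<tau>)\<bar> powr p"
        using l p by (intro powr_mono2) auto
      moreover have "(l k * \<beta> powr - m * (2 * (B * 4 ^ k)) powr - q) powr p = g j"
      proof -
        have "((2 * (B * 4 ^ k)) powr - q) powr p = (2 * (B * 4 ^ k)) powr - 1"
          by (simp only: powr_powr qp(1)[OF i0])
        also have "\<dots> = 1 / (2 * (B * 4 ^ k))"
          using Bk by (intro powr_neg_one) simp
        finally have 1: "((2 * (B * 4 ^ k)) powr - q) powr p = 1 / (2 * (B * 4 ^ k))" .
        have "(l k * \<beta> powr - m * (2 * (B * 4 ^ k)) powr - q) powr p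
            = l k powr p * (\<beta> powr - m) powr p * ((2 * (B * 4 ^ k)) powr - q) powr p"
          using l by (simp add: powr_mult)
        also have "\<dots> = g j"
          unfolding 1 unfolding powr_powr by (simp add: Suc g_def)
        finally show ?thesis .
      qed
      ultimately show ?thesis
        by (simp add: G_def)
    qed
    have N: "c * (t * (\<beta> / t) ^ (DIM('a) - 1)) * (\<Sum>j\<in>{..i}. g j * (hi j - lo j)) \<le> Nop G (x, t)"
    proof (rule Nop_ge[OF _ _ \<beta>_def \<beta>(2)])
      show "continuous_on (UNIV \<times> {0..t}) G"
        unfolding G_def using p t by (intro continuous_on_powr' continuous_intros continuous_on_subset[OF U]) auto
      show "0 \<le> G z" for z
        by (simp add: G_def)
      fix j assume j: "j \<in> {..i}"
      \<comment> \<open>The last strip ends at B * 4 ^ i / 2, or at b < B / 2 when i = 0; both are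
        at most \<beta> / 2.\<close>
      show "0 \<le> lo j \<and> lo j \<le> hi j \<and> hi j \<le> \<beta> / 2 \<and> 0 \<le> g j"
      proof (cases j)
        case 0
        then show ?thesis
          using ab \<beta> by (simp add: lo_def hi_def g_def)
      next
        case (Suc k)
        have "(4::real) ^ Suc k \<le> 4 ^ i"
          using j Suc by (intro power_increasing) auto
        then have "B * 4 ^ Suc k \<le> B * 4 ^ i"
          using B by (intro mult_left_mono) auto
        moreover have "B * 4 ^ Suc k = 4 * (B * 4 ^ k)"
          by simp
        ultimately have "4 * (B * 4 ^ k) \<le> \<beta>"
          using \<beta>B unfolding \<beta>_def by linarith
        then show ?thesis
          using Suc B by (simp add: lo_def hi_def g_def)
      qed
    next
      fix y :: 'a and \<tau>
      assume \<tau>: "0 \<le> \<tau>" "\<tau> \<le> \<beta>"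
      show "(\<Sum>j\<in>{..i}. g j * indicator {lo j..hi j} (\<tau> - norm y)) \<le> G (y, \<tau>)"
      proof (cases "\<exists>j\<in>{..i}. \<tau> - norm y \<in> {lo j..hi j}")
        case True
        then obtain j where j: "j \<in> {..i}" "\<tau> - norm y \<in> {lo j..hi j}"
          by blast
        have "indicator {lo h..hi h} (\<tau> - norm y) = (0::real)" if "h \<noteq> j" for h
          using gap[of h j] gap[of j h] that j(2) by (auto simp: indicator_def neq_iff)
        then have "(\<Sum>h\<in>{..i}. g h * indicator {lo h..hi h} (\<tau> - norm y)) = (\<Sum>h\<in>{..i}. if h = j then g j else 0)"
          using j by (intro sum.cong refl) auto
        also have "\<dots> = g j"
          using j by simp
        also have "\<dots> \<le> G (y, \<tau>)"
          using g_le \<tau> j by auto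
        finally show ?thesis .
      next
        case False
        then have "(\<Sum>j\<in>{..i}. g j * indicator {lo j..hi j} (\<tau> - norm y)) = 0"
          by (intro sum.neutral) (auto simp: indicator_def)
        then show ?thesis
          by (simp add: G_def)
      qed
    qed auto
    define L where "L = (b - a) * v powr p + (\<Sum>j<i. l j powr p / 2)"
    have "(\<Sum>j\<in>{..i}. g j * (hi j - lo j)) = g 0 * (hi 0 - lo 0) + (\<Sum>j<i. g (Suc j) * (hi (Suc j) - lo (Suc j)))"
      by (rule sum.atMost_shift)
    \<comment> \<open>The strip length B * 4 ^ j cancels against the denominator in
      \<open>g\<close>, leaving the same factor 1/2 at every scale.\<close>
    also have "(\<Sum>j<i. g (Suc j) * (hi (Suc j) - lo (Suc j))) = (\<Sum>j<i. \<beta> powr (- m * p) * (l j powr p / 2))"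
      using B by (intro sum.cong refl) (simp add: g_def hi_def lo_def)
    also have "g 0 * (hi 0 - lo 0) + \<dots> = \<beta> powr (- m * p) * L"
      by (simp add: g_def hi_def lo_def L_def sum_distrib_left algebra_simps)
    finally have sum: "(\<Sum>j\<in>{..i}. g j * (hi j - lo j)) = \<beta> powr (- m * p) * L" .
    \<comment> \<open>Since n - 1 = m + 1 and q = m p - (m + 1), the geometric factor reproduces the
      shape of the profile exactly.\<close>
    have "t * (\<beta> / t) ^ (DIM('a) - 1) * \<beta> powr (- m * p) = t powr - m * \<beta> powr - q"
    proof -
      have n: "real (DIM('a) - 1) = m + 1"
        using dim by (simp add: m_def of_nat_diff)
      have "(\<beta> / t) ^ N = \<beta> powr real N / t powr real N" for N
        using \<beta> by (simp add: powr_realpow power_divide)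
      from this[of "DIM('a) - 1"] have "(\<beta> / t) ^ (DIM('a) - 1) = \<beta> powr (m + 1) / t powr (m + 1)"
        by (simp only: n)
      moreover have "\<beta> powr (m + 1) * \<beta> powr (- m * p) = \<beta> powr - q"
        unfolding powr_add[symmetric] by (simp add: q_def)
      moreover have "t / t powr (m + 1) = t powr - m"
        using \<beta> by (simp add: powr_add powr_minus field_simps)
      moreover have "t * (\<beta> powr (m + 1) / t powr (m + 1)) * \<beta> powr (- m * p)
          = t / t powr (m + 1) * (\<beta> powr (m + 1) * \<beta> powr (- m * p))"
        by simp
      ultimately show ?thesis
        by (simp only:)
    qed
    then have "c * L * (t powr - m * \<beta> powr - q) \<le> Nop G (x, t)"
      using N unfolding sum by (simp add: mult_ac)
    also have "\<dots> \<le> U (x, t)"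
      using Nop[OF t, of x] \<beta> unfolding G_def \<beta>_def by auto
    finally show "c * ((b - a) * v powr p + (\<Sum>j<i. l j powr p / 2)) * t powr - m * (t - norm x) powr - q \<le> U (x, t)"
      by (simp add: L_def \<beta>_def mult.assoc)
  qed
  then show ?thesis
    by (rule that[OF c])
qed

section \<open>The critical exponent and the length of the recursion\<close>

text \<open>Completing the square gives 2 (n - 2) zeta = R^2 - (2 (n - 2) p - (n - 1))^2, a product
  of two linear factors. One is positive by p < p1 n, the other because R \<ge> n - 1 makes the
  smaller root of zeta nonpositive.\<close>

lemma zeta_pos:
  assumes "3 \<le> n" "1 < p" "p < p1 n"
  shows "0 < zeta p n"
proof -
  define R where "R = sqrt (n\<^sup>2 + 2 * n - 7)"
  have sq: "R\<^sup>2 = n\<^sup>2 + 2 * n - 7"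
    unfolding R_def using assms power_mono[of 3 n 2] by (intro real_sqrt_pow2) simp
  have "n - 1 \<le> R"
    unfolding R_def using assms(1) by (intro real_le_rsqrt) (simp add: power2_eq_square algebra_simps)
  have "2 * (n - 2) * p < n - 1 + R"
    using assms by (simp add: p1_def R_def field_simps)
  moreover have "0 < (n - 2) * (p - 1)"
    using assms by simp
  then have "n - 1 - R < 2 * (n - 2) * p"
    using \<open>n - 1 \<le> R\<close> assms by (simp add: algebra_simps)
  ultimately have "0 < (n - 1 + R - 2 * (n - 2) * p) * (2 * (n - 2) * p - (n - 1 - R))"
    by simp
  also have "\<dots> = R\<^sup>2 - (2 * (n - 2) * p - (n - 1))\<^sup>2"
    by (simp add: power2_eq_square algebra_simps)
  also have "\<dots> = 2 * (n - 2) * zeta p n"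
    unfolding sq zeta_def by (simp add: power2_eq_square algebra_simps)
  finally show ?thesis
    using assms(1) by (simp add: zero_less_mult_iff)
qed

lemma zeta_p1:
  assumes "3 \<le> n"
  shows "zeta (p1 n) n = 0"
proof -
  define R where "R = sqrt (n\<^sup>2 + 2 * n - 7)"
  have sq: "R\<^sup>2 = n\<^sup>2 + 2 * n - 7"
    unfolding R_def using assms power_mono[of 3 n 2] by (intro real_sqrt_pow2) simp
  have R: "2 * (n - 2) * p1 n - (n - 1) = R"
    using assms by (simp add: p1_def R_def field_simps)
  have "2 * (n - 2) * zeta (p1 n) n = R\<^sup>2 - (2 * (n - 2) * p1 n - (n - 1))\<^sup>2"
    unfolding sq zeta_def by (simp add: power2_eq_square algebra_simps)
  then have "2 * (n - 2) * zeta (p1 n) n = 0"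
    by (simp only: R cancel_comm_monoid_add_class.diff_cancel)
  then show ?thesis
    using assms by simp
qed

text \<open>The increments mimic $y' = c y^p$, for which $y^{1-p}$ decreases at a constant rate.\<close>
lemma superlinear_recursion_length:
  fixes p c K :: real
  assumes p: "p > 1" and c: "c > 0" and K: "K > 0"
  obtains C where "C > 0" and
    "\<And>(y::nat \<Rightarrow> real) N. 0 < y 0 \<Longrightarrow> (\<And>i. y (Suc i) = y i + c * y i powr p) \<Longrightarrow>
      (\<And>i. i \<le> N \<Longrightarrow> y i powr (p - 1) < K) \<Longrightarrow> real N \<le> C * y 0 powr (1 - p)"
proof -
  \<comment> \<open>\<open>k\<close> bounds the relative increment z = c y^(p-1). For 0 < z < k one
    has (1 + z)^(p-1) \<ge> 1 + b z and 1 / (1 + b z) \<le> 1 - b z / (1 + b k). As y^(1-p) z = c,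
    each step lowers y^(1-p) by at least \<eta>.\<close>
  define k where "k = c * K"
  define b where "b = (p - 1) / (1 + k)"
  define \<eta> where "\<eta> = b / (1 + b * k) * c"
  have k: "0 < k"
    using c K by (simp add: k_def)
  then have b: "0 < b"
    using p by (simp add: b_def)
  have \<eta>: "0 < \<eta>"
    using c k b by (simp add: \<eta>_def add_pos_nonneg)
  have "real N \<le> 1 / \<eta> * y 0 powr (1 - p)"
    if y0: "0 < y 0" and rec: "\<And>i. y (Suc i) = y i + c * y i powr p"
      and small: "\<And>i. i \<le> N \<Longrightarrow> y i powr (p - 1) < K" for y :: "nat \<Rightarrow> real" and N
  proof -
    have pos: "0 < y i" for i
      by (induction i) (use y0 c in \<open>auto simp: rec intro!: add_pos_pos\<close>)
    have step: "y (Suc i) powr (1 - p) \<le> y i powr (1 - p) - \<eta>" if "i < N" for i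
    proof -
      define z where "z = c * y i powr (p - 1)"
      have z: "0 < z" "z < k"
        using pos[of i] c small[of i] that by (auto simp: z_def k_def)
      have "y i powr p = y i * y i powr (p - 1)"
        using pos[of i] by (simp add: powr_diff)
      then have "y (Suc i) = y i * (1 + z)"
        by (simp add: rec z_def algebra_simps)
      then have "y (Suc i) powr (1 - p) = y i powr (1 - p) * (1 + z) powr (1 - p)"
        using pos[of i] z by (simp add: powr_mult)
      also have "(1 + z) powr (1 - p) \<le> 1 / (1 + b * z)"
      proof -
        \<comment> \<open>This is ln w \<le> w - 1 at w = 1 / (1 + z).\<close>
        have "z / (1 + z) \<le> ln (1 + z)"
        proof -
          have "ln (1 / (1 + z)) \<le> 1 / (1 + z) - 1"
            using z by (intro ln_le_minus_one) auto
          then show ?thesis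
            using z by (simp add: ln_div field_simps)
        qed
        moreover have "z / (1 + k) \<le> z / (1 + z)"
          using z by (intro divide_left_mono) auto
        ultimately have "(p - 1) * (z / (1 + k)) \<le> (p - 1) * ln (1 + z)"
          using p by (intro mult_left_mono) auto
        then have "1 + b * z \<le> 1 + (p - 1) * ln (1 + z)"
          by (simp add: b_def)
        also have "\<dots> \<le> exp ((p - 1) * ln (1 + z))"
          by (rule exp_ge_add_one_self)
        also have "\<dots> = (1 + z) powr (p - 1)"
          using z by (simp add: powr_def)
        finally have "1 + b * z \<le> (1 + z) powr (p - 1)" .
        moreover have "0 < 1 + b * z"
          using b z by (simp add: add_pos_pos)
        moreover have "(1 + z) powr (1 - p) = 1 / (1 + z) powr (p - 1)"
          using powr_minus_divide[of "1 + z" "p - 1"] by simp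
        ultimately show ?thesis
          by (simp add: frac_le)
      qed
      also have "1 / (1 + b * z) \<le> 1 - b * z / (1 + b * k)"
      proof -
        have bz: "0 < 1 + b * z"
          using b z by (simp add: add_pos_pos)
        have "1 / (1 + b * z) = 1 - b * z / (1 + b * z)"
          using bz by (simp add: field_simps)
        moreover have "b * z / (1 + b * k) \<le> b * z / (1 + b * z)"
          using bz b z k by (intro divide_left_mono mult_pos_pos) (auto intro: add_pos_pos)
        ultimately show ?thesis
          by linarith
      qed
      finally have "y (Suc i) powr (1 - p) \<le> y i powr (1 - p) * (1 - b * z / (1 + b * k))"
        by (simp add: mult_left_mono)
      also have "\<dots> = y i powr (1 - p) - \<eta>"
      proof -
        have "y i powr (1 - p) * y i powr (p - 1) = 1"
          using pos[of i] by (simp flip: powr_add)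
        then have "y i powr (1 - p) * z = c"
          by (simp add: z_def)
        moreover have "y i powr (1 - p) * (b * z / (1 + b * k)) = b / (1 + b * k) * (y i powr (1 - p) * z)"
          by simp
        ultimately have "y i powr (1 - p) * (b * z / (1 + b * k)) = \<eta>"
          by (simp only: \<eta>_def)
        then show ?thesis
          by (simp add: right_diff_distrib)
      qed
      finally show ?thesis
        by (simp add: mult_left_mono)
    qed
    have "y i powr (1 - p) \<le> y 0 powr (1 - p) - real i * \<eta>" if "i \<le> N" for i
      using that
    proof (induction i)
      case (Suc i)
      then show ?case
        using step[of i] by (simp add: algebra_simps)
    qed simp
    \<comment> \<open>The decreasing quantity never becomes negative, which limits the number of
      steps.\<close>
    from this[of N] have "real N * \<eta> \<le> y 0 powr (1 - p)"
      using powr_ge_zero[of "y N" "1 - p"] by linarith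
    then show ?thesis
      using \<eta> by (simp add: field_simps)
  qed
  moreover have "0 < 1 / \<eta>"
    using \<eta> by simp
  ultimately show ?thesis
    using that by blast
qed

section \<open>From solutions to lifespan bounds\<close>

lemma Nop_nonneg:
  fixes G :: "'a::euclidean_space \<times> real \<Rightarrow> real"
  assumes "DIM('a) \<ge> 3" "0 \<le> t" "continuous_on (UNIV \<times> {0..t}) G" "\<And>z. 0 \<le> G z"
  shows "0 \<le> Nop G (x, t)"
  using Nop_ge[OF assms, where D = "{}" and m = 0 and x = x] by simp

lemma is_solution_continuous:
  assumes "is_solution p \<epsilon> g u T"
  shows "continuous_on (UNIV \<times> {0..T}) u"
proof -
  obtain u' where "\<forall>z\<in>UNIV \<times> {0..T}. (u has_derivative u' z) (at z within UNIV \<times> {0..T})"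
    using assms unfolding is_solution_def C1_on_def C2_on_def by (cases "2 \<le> p") auto
  then show ?thesis
    unfolding continuous_on_eq_continuous_within using has_derivative_continuous by blast
qed

lemma lifespan_leI:
  assumes "\<And>T u. 0 < T \<Longrightarrow> is_solution p \<epsilon> g u T \<Longrightarrow> T \<le> L"
  shows "lifespan p \<epsilon> g \<le> ereal L"
  unfolding lifespan_def using assms by (auto intro!: Sup_least)

lemma is_solution_lower_bounds:
  fixes u :: "'a::euclidean_space \<times> real \<Rightarrow> real" and g0 :: "real \<Rightarrow> real"
  assumes dim: "DIM('a) \<ge> 3" and p: "p > 1" and \<epsilon>: "0 < \<epsilon>"
    and sol: "is_solution p \<epsilon> (\<lambda>x::'a. g0 (norm x)) u T"
  shows "\<lbrakk>\<forall>r\<ge>0. r > k \<longrightarrow> g0 r = 0; 0 \<le> k; t \<le> T; k < t - norm x\<rbrakk>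
      \<Longrightarrow> Nop (\<lambda>z. \<bar>u z\<bar> powr p) (x, t) \<le> u (x, t)"
    and "\<lbrakk>w \<le> Vfree (\<lambda>_. 0) (\<lambda>x::'a. g0 (norm x)) (x, t); 0 \<le> t; t \<le> T\<rbrakk> \<Longrightarrow> \<epsilon> * w \<le> u (x, t)"
proof -
  have eq: "u (x, t) = \<epsilon> * Vfree (\<lambda>_. 0) (\<lambda>x::'a. g0 (norm x)) (x, t) + Nop (\<lambda>z. \<bar>u z\<bar> powr p) (x, t)"
    if "0 \<le> t" "t \<le> T" for x t
    using sol that unfolding is_solution_def by auto
  show "Nop (\<lambda>z. \<bar>u z\<bar> powr p) (x, t) \<le> u (x, t)"
    if supp: "\<forall>r\<ge>0. r > k \<longrightarrow> g0 r = 0" and t: "0 \<le> k" "t \<le> T" "k < t - norm x"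
  proof -
    have t0: "0 \<le> t"
      using t norm_ge_zero[of x] by linarith
    have "Vfree (\<lambda>_. 0) (\<lambda>x::'a. g0 (norm x)) (x, t) = 0"
    proof (rule Vfree_zero_eq_0[OF t0])
      fix z assume "norm (z - x) = t"
      then have "k < norm z"
        using t norm_triangle_ineq4[of z x] by linarith
      then show "g0 (norm z) = 0"
        using supp by simp
    qed
    then show ?thesis
      using eq[OF t0 t(2), of x] by simp
  qed
  show "\<epsilon> * w \<le> u (x, t)"
    if w: "w \<le> Vfree (\<lambda>_. 0) (\<lambda>x::'a. g0 (norm x)) (x, t)" and t: "0 \<le> t" "t \<le> T"
  proof -
    have "0 \<le> Nop (\<lambda>z. \<bar>u z\<bar> powr p) (x, t)"
      using p t by (intro Nop_nonneg[OF dim] continuous_on_powr' continuous_intros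
          continuous_on_subset[OF is_solution_continuous[OF sol]]) auto
    moreover have "\<epsilon> * w \<le> \<epsilon> * Vfree (\<lambda>_. 0) (\<lambda>x::'a. g0 (norm x)) (x, t)"
      using w \<epsilon> by simp
    ultimately show ?thesis
      using eq[OF t, of x] by linarith
  qed
qed

theorem theorem2p3:
  fixes g0 :: "real \<Rightarrow> real" and p k k0 :: real
  assumes n3: "CARD('n) \<ge> 3"
    and p_gt: "p > 1"
    and g0_C2: "\<exists>g1 g2. (\<forall>r\<ge>0. (g0 has_real_derivative g1 r) (at r within {0..})) \<and>
                        (\<forall>r\<ge>0. (g1 has_real_derivative g2 r) (at r within {0..})) \<and>
                        continuous_on {0..} g2"
    and k_pos: "k > 0"
    and supp: "\<forall>r\<ge>0. r > k \<longrightarrow> g0 r = 0"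
    and k0: "0 < k0" "k0 < k"
    and pos: "\<forall>r. k0 < r \<and> r < k \<longrightarrow> g0 r > 0"
  shows "\<exists>\<epsilon>0>0. \<exists>C>0. \<forall>\<epsilon>. 0 < \<epsilon> \<and> \<epsilon> \<le> \<epsilon>0 \<longrightarrow>
           (p < p1 (real CARD('n)) \<longrightarrow>
              lifespan p \<epsilon> (\<lambda>x::real^'n. g0 (norm x))
                \<le> ereal (C * \<epsilon> powr (- 2 * p * (p - 1) / zeta p (real CARD('n))))) \<and>
           (p = p1 (real CARD('n)) \<longrightarrow>
              lifespan p \<epsilon> (\<lambda>x::real^'n. g0 (norm x))
                \<le> ereal (exp (C * \<epsilon> powr (- p * (p - 1)))))"
proof -
  let ?n = "real CARD('n)"
  let ?g = "\<lambda>x::real^'n. g0 (norm x)"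
  have dim: "DIM(real^'n) \<ge> 3" and n: "real DIM(real^'n) = ?n"
    using n3 by simp_all
  have cont: "continuous_on {0..} g0"
    unfolding continuous_on_eq_continuous_within using g0_C2 by (auto intro: DERIV_continuous)
  obtain a b v where ab: "0 < a" "a < b" "b < k" and v: "0 < v"
    and Vge: "\<And>(x::real^'n) t. a \<le> t - norm x \<Longrightarrow> t - norm x \<le> b \<Longrightarrow>
      v * t powr - (?n - 2) \<le> Vfree (\<lambda>_. 0) ?g (x, t)"
    using Vfree_radial_bounds[OF dim cont supp k0 pos] unfolding n by blast
  obtain c where c: "c > 0" and step: "\<And>(U :: (real^'n) \<times> real \<Rightarrow> real) T a b B v l i.
      continuous_on (UNIV \<times> {0..T}) U \<Longrightarrow> 0 < a \<Longrightarrow> a \<le> b \<Longrightarrow> 2 * b < B \<Longrightarrow> 0 \<le> v \<Longrightarrow>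
      (\<And>x t. t \<le> T \<Longrightarrow> B \<le> t - norm x \<Longrightarrow> Nop (\<lambda>z. \<bar>U z\<bar> powr p) (x, t) \<le> U (x, t)) \<Longrightarrow>
      (\<And>x t. t \<le> T \<Longrightarrow> a \<le> t - norm x \<Longrightarrow> t - norm x \<le> b \<Longrightarrow> v * t powr - (?n - 2) \<le> U (x, t)) \<Longrightarrow>
      i = 0 \<or> zeta p ?n = 0 \<Longrightarrow>
      (\<And>j. j < i \<Longrightarrow> 0 \<le> l j \<and> profile_bound p T (B * 4 ^ j) (l j) U) \<Longrightarrow>
      profile_bound p T (B * 4 ^ i) (c * ((b - a) * v powr p + (\<Sum>j<i. l j powr p / 2))) U"
  proof (rule profile_bound_step[OF dim p_gt, unfolded n], goal_cases)
    case (1 c)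
    show ?case
      by (rule 1(1), fact 1(2), fact 1(3))
  qed
  obtain K where K: "K > 0" and blowup: "\<And>(U :: (real^'n) \<times> real \<Rightarrow> real) T B \<kappa>.
      0 < B \<Longrightarrow> 3 * B \<le> T \<Longrightarrow> 0 < \<kappa> \<Longrightarrow> continuous_on (UNIV \<times> {0..T}) U \<Longrightarrow> profile_bound p T B \<kappa> U \<Longrightarrow>
      (\<And>x t. t \<le> T \<Longrightarrow> B \<le> t - norm x \<Longrightarrow> Nop (\<lambda>z. \<bar>U z\<bar> powr p) (x, t) \<le> U (x, t)) \<Longrightarrow>
      \<kappa> powr (p - 1) * T powr (zeta p ?n / 2) < K"
  proof (rule profile_bound_blowup[OF dim p_gt, unfolded n], goal_cases)
    case (1 c)
    show ?case
      by (rule 1(1), fact 1(2), fact 1(3))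
  qed
  obtain R where R: "R > 0" and recursion: "\<And>(y::nat \<Rightarrow> real) N. 0 < y 0 \<Longrightarrow>
      (\<And>i. y (Suc i) = y i + c / 2 * y i powr p) \<Longrightarrow>
      (\<And>i. i \<le> N \<Longrightarrow> y i powr (p - 1) < K) \<Longrightarrow> real N \<le> R * y 0 powr (1 - p)"
    using superlinear_recursion_length[OF p_gt _ K, of "c / 2"] c by (metis half_gt_zero)
  \<comment> \<open>2 k exceeds 2 * b, as \<open>step\<close> requires, and exceeds k, so the free
    part vanishes for t - |x| \<ge> B.\<close>
  define B where "B = 2 * k"
  define A where "A = c * (b - a) * v powr p"
  \<comment> \<open>The coefficient of the profile at scale B * 4 ^ i. It starts from what the data
    strip alone gives; the 1/2 in the increment is the one attached to each strip in
    \<open>step\<close>.\<close>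
  define y where "y \<epsilon> = rec_nat (A * \<epsilon> powr p) (\<lambda>_ r. r + c / 2 * r powr p)" for \<epsilon>
  have B: "0 < B" and A: "0 < A"
    using k_pos c ab v by (auto simp: B_def A_def)
  have y_Suc: "y \<epsilon> (Suc i) = y \<epsilon> i + c / 2 * y \<epsilon> i powr p" and y_0: "y \<epsilon> 0 = A * \<epsilon> powr p" for \<epsilon> i
    by (simp_all add: y_def)
  have y_pos: "0 < y \<epsilon> i" if "0 < \<epsilon>" for \<epsilon> i
    by (induction i) (use A c that in \<open>auto simp: y_0 y_Suc intro!: add_pos_pos\<close>)
  have y_sum: "y \<epsilon> i = c * ((b - a) * (\<epsilon> * v) powr p + (\<Sum>j<i. y \<epsilon> j powr p / 2))" if "0 < \<epsilon>" for \<epsilon> i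
    \<comment> \<open>Each increment of the recursion is the summand of one further strip.\<close>
    by (induction i) (use that v in \<open>simp_all add: y_0 y_Suc A_def powr_mult algebra_simps\<close>)
  \<comment> \<open>One estimate serves both cases: i = 0 for p < p1, and every i with 3 * (B * 4 ^
    i) \<le> T for the critical p.\<close>
  have bound: "y \<epsilon> i powr (p - 1) * T powr (zeta p ?n / 2) < K"
    if \<epsilon>: "0 < \<epsilon>" and sol: "is_solution p \<epsilon> ?g u T" and i: "i = 0 \<or> zeta p ?n = 0" and T: "3 * (B * 4 ^ i) \<le> T"
    for \<epsilon> T u i
  proof -
    have u: "continuous_on (UNIV \<times> {0..T}) u"
      by (rule is_solution_continuous[OF sol])
    have Nop_le: "Nop (\<lambda>z. \<bar>u z\<bar> powr p) (x, t) \<le> u (x, t)" if "t \<le> T" "B \<le> t - norm x" for x t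
      using is_solution_lower_bounds(1)[OF dim p_gt \<epsilon> sol supp _ that(1)] that k_pos by (simp add: B_def)
    have strip: "\<epsilon> * v * t powr - (?n - 2) \<le> u (x, t)"
      if "t \<le> T" "a \<le> t - norm x" "t - norm x \<le> b" for x t
    proof -
      have "0 \<le> t"
        using that ab norm_ge_zero[of x] by linarith
      then show ?thesis
        using is_solution_lower_bounds(2)[OF dim p_gt \<epsilon> sol Vge] that by (simp add: mult.assoc)
    qed
    have profile: "profile_bound p T (B * 4 ^ j) (y \<epsilon> j) u" if "j = 0 \<or> zeta p ?n = 0" for j
      using that
    proof (induction j rule: less_induct)
      case (less j)
      show ?case
        unfolding y_sum[OF \<epsilon>, of j]
      proof (rule step[OF u _ _ _ _ Nop_le strip less.prems])
        show "0 \<le> y \<epsilon> h \<and> profile_bound p T (B * 4 ^ h) (y \<epsilon> h) u" if "h < j" for h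
          using that less y_pos[OF \<epsilon>, of h] by auto
      qed (use ab v \<epsilon> in \<open>auto simp: B_def\<close>)
    qed
    have "B * 1 \<le> B * 4 ^ i"
      using B by (intro mult_left_mono) auto
    then have "B \<le> t - norm x" if "B * 4 ^ i \<le> t - norm x" for x :: "real^'n" and t
      using that by linarith
    then show ?thesis
      using B by (intro blowup[OF _ T y_pos[OF \<epsilon>] u profile[OF i] Nop_le]) auto
  qed
  \<comment> \<open>3 * B takes care of T < 3 * B; the other term comes from solving the bound at i
    = 0 for T. At zeta = 0 the quotient 2 / zeta is 0 by convention, and only the positivity of
    \<open>Csub\<close> matters.\<close>
  define Csub where "Csub = 3 * B + (K / A powr (p - 1)) powr (2 / zeta p ?n)"
  \<comment> \<open>This comes from the logarithm of 12 * B * 4 ^ N once N is bounded by the length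
    of the recursion.\<close>
  define Ccrit where "Ccrit = \<bar>ln (12 * B)\<bar> + ln 4 * (R * A powr (1 - p))"
  have C: "0 < Csub" "0 \<le> Ccrit"
    using B R by (auto simp: Csub_def Ccrit_def intro: add_pos_nonneg)
  have sub: "lifespan p \<epsilon> ?g \<le> ereal ((Csub + Ccrit) * \<epsilon> powr (- 2 * p * (p - 1) / zeta p ?n))"
    if \<epsilon>: "0 < \<epsilon>" "\<epsilon> \<le> 1" and p: "p < p1 ?n" for \<epsilon>
  proof (rule lifespan_leI)
    fix T u assume T: "0 < T" and sol: "is_solution p \<epsilon> ?g u T"
    let ?z = "zeta p ?n"
    let ?E = "\<epsilon> powr (- 2 * p * (p - 1) / ?z)"
    have z: "0 < ?z"
      using n3 p p_gt by (intro zeta_pos) auto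
    have neg: "- 2 * p * (p - 1) / ?z \<le> 0"
      using z p_gt by (intro divide_nonpos_pos mult_nonpos_nonneg) auto
    \<comment> \<open>Here \<epsilon> \<le> 1 enters: additive constants can be absorbed into
      multiples of this power of \<epsilon>.\<close>
    have E: "1 \<le> ?E"
      using \<epsilon> powr_mono2'[OF neg, of \<epsilon> 1] by simp
    have "T \<le> Csub * ?E"
    proof (cases "3 * B \<le> T")
      case True
      have "(A * \<epsilon> powr p) powr (p - 1) * T powr (?z / 2) < K"
        using bound[OF \<epsilon>(1) sol, of 0] True by (simp add: y_0)
      then have "A powr (p - 1) * \<epsilon> powr (p * (p - 1)) * T powr (?z / 2) < K"
        using A by (simp add: powr_mult powr_powr)
      moreover have "0 < A powr (p - 1) * \<epsilon> powr (p * (p - 1))"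
        using A \<epsilon> by simp
      ultimately have "T powr (?z / 2) < K / (A powr (p - 1) * \<epsilon> powr (p * (p - 1)))"
        by (subst pos_less_divide_eq) (simp_all add: mult_ac)
      then have "T powr (?z / 2) < K / A powr (p - 1) * \<epsilon> powr (- (p * (p - 1)))"
        unfolding powr_minus by (simp only: divide_inverse inverse_mult_distrib mult.assoc)
      then have "(T powr (?z / 2)) powr (2 / ?z) \<le> (K / A powr (p - 1) * \<epsilon> powr (- (p * (p - 1)))) powr (2 / ?z)"
        using z by (intro powr_mono2) auto
      also have "(T powr (?z / 2)) powr (2 / ?z) = T"
        using z T by (simp add: powr_powr)
      also have "(K / A powr (p - 1) * \<epsilon> powr (- (p * (p - 1)))) powr (2 / ?z)
          = (K / A powr (p - 1)) powr (2 / ?z) * (\<epsilon> powr (- (p * (p - 1)))) powr (2 / ?z)"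
        using K A by (intro powr_mult)
      also have "(\<epsilon> powr (- (p * (p - 1)))) powr (2 / ?z) = ?E"
        unfolding powr_powr by (simp add: mult_ac)
      also have "(K / A powr (p - 1)) powr (2 / ?z) * ?E \<le> Csub * ?E"
        using B by (intro mult_right_mono) (auto simp: Csub_def)
      finally show ?thesis .
    next
      case False
      then have "T \<le> Csub * 1"
        using powr_ge_zero[of "K / A powr (p - 1)" "2 / ?z"] unfolding Csub_def mult_1_right by linarith
      also have "\<dots> \<le> Csub * ?E"
        using E C by (intro mult_left_mono) auto
      finally show ?thesis .
    qed
    also have "\<dots> \<le> (Csub + Ccrit) * ?E"
      using C by (intro mult_right_mono) auto
    finally show "T \<le> (Csub + Ccrit) * ?E" .
  qed
  have crit: "lifespan p \<epsilon> ?g \<le> ereal (exp ((Csub + Ccrit) * \<epsilon> powr (- p * (p - 1))))"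
    if \<epsilon>: "0 < \<epsilon>" "\<epsilon> \<le> 1" and p: "p = p1 ?n" for \<epsilon>
  proof (rule lifespan_leI)
    fix T u assume T: "0 < T" and sol: "is_solution p \<epsilon> ?g u T"
    let ?E = "\<epsilon> powr (- p * (p - 1))"
    have z: "zeta p ?n = 0"
      using n3 zeta_p1[of ?n] p by simp
    have E: "1 \<le> ?E"
      using \<epsilon> powr_mono2'[of "- p * (p - 1)" \<epsilon> 1] p_gt by (simp add: mult_nonpos_nonneg)
    \<comment> \<open>The scales i < M are those at which T is large enough for the blow-up
      criterion.\<close>
    obtain M :: nat where "T < 3 * B * 4 ^ M" and least: "\<And>i. i < M \<Longrightarrow> 3 * B * 4 ^ i \<le> T"
    proof -
      obtain M :: nat where "T / (3 * B) < 4 ^ M"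
        using real_arch_pow[of 4] by auto
      then have "T < 3 * B * 4 ^ M"
        using B by (simp add: field_simps)
      then show ?thesis
        using that[of "LEAST i. T < 3 * B * 4 ^ i"] by (metis (mono_tags, lifting) LeastI not_less_Least not_le)
    qed
    \<comment> \<open>The last usable scale. For M = 0 truncated subtraction gives N = 0, and T < 12
      B 4^N holds in that case as well.\<close>
    define N where "N = M - 1"
    have "T < 12 * B * 4 ^ N"
      using \<open>T < 3 * B * 4 ^ M\<close> B by (cases M) (auto simp: N_def)
    have N: "real N \<le> R * A powr (1 - p) * ?E"
    proof (cases "M = 0")
      case False
      have "real N \<le> R * y \<epsilon> 0 powr (1 - p)"
      proof (rule recursion[of "y \<epsilon>", OF y_pos[OF \<epsilon>(1)] y_Suc])
        fix i assume "i \<le> N"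
        then have "i < M"
          using False by (simp add: N_def)
        then have "3 * (B * 4 ^ i) \<le> T"
          using least[of i] by (simp add: mult.assoc)
        \<comment> \<open>With zeta = 0 and T > 0 the power of T in the criterion is 1, so the bound
          on the coefficient does not involve T.\<close>
        then show "y \<epsilon> i powr (p - 1) < K"
          using bound[OF \<epsilon>(1) sol, of i] z T by simp
      qed
      moreover have "p * (1 - p) = - p * (p - 1)"
        by (simp add: algebra_simps)
      ultimately show ?thesis
        using A by (simp add: y_0 powr_mult powr_powr)
    qed (use R in \<open>simp add: N_def\<close>)
    have "ln (12 * B) + real N * ln 4 \<le> \<bar>ln (12 * B)\<bar> * ?E + ln 4 * (R * A powr (1 - p)) * ?E"
    proof (rule add_mono)
      show "ln (12 * B) \<le> \<bar>ln (12 * B)\<bar> * ?E"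
        using mult_left_mono[OF E, of "\<bar>ln (12 * B)\<bar>"] by linarith
      show "real N * ln 4 \<le> ln 4 * (R * A powr (1 - p)) * ?E"
        using mult_left_mono[OF N, of "ln 4"] by (simp add: mult_ac)
    qed
    also have "\<dots> = Ccrit * ?E"
      by (simp add: Ccrit_def distrib_right)
    also have "\<dots> \<le> (Csub + Ccrit) * ?E"
      using C by (intro mult_right_mono) auto
    finally have "exp (ln (12 * B) + real N * ln 4) \<le> exp ((Csub + Ccrit) * ?E)"
      by simp
    moreover have "exp (ln (12 * B) + real N * ln 4) = 12 * B * 4 ^ N"
      using B by (simp add: exp_add exp_of_nat_mult)
    ultimately show "T \<le> exp ((Csub + Ccrit) * ?E)"
      using \<open>T < 12 * B * 4 ^ N\<close> by linarith
  qed
  have "0 < Csub + Ccrit"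
    using C by linarith
  \<comment> \<open>The threshold is \<epsilon>0 = 1, and the sum of both constants serves either
    case, each being nonnegative.\<close>
  show ?thesis
    by (rule exI[of _ 1], rule conjI[OF zero_less_one], rule exI[of _ "Csub + Ccrit"],
        rule conjI[OF \<open>0 < Csub + Ccrit\<close>]) (use sub crit in blast)
qed

end
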